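(* Let $\{u_\varepsilon\}_{\varepsilon>0}$ be a bounded sequence in $L^2_\theta(\mathbb{R}^3)$ and let $\tilde\omega\in\widetilde\Omega$. Then there exists a function $u\in L^2_{\mathrm{loc}}(\mathbb{R}^3\times\Omega)$ such that $\mathbb{E}[u]\in L^2_\theta(\mathbb{R}^3)$ and, up to subsequences, $$\lim_{\varepsilon\to0}\int_{\mathbb{R}^3}u_\varepsilon(x)\phi(x)b(T_{x/\varepsilon}\tilde\omega)\,dx=\int_{\mathbb{R}^3\times\Omega}u(x,\omega)\phi(x)b(\omega)\,d\mathbb{P}(\omega)\,dx$$ for all $\phi\in C_c^\infty(\mathbb{R}^3)$ and $b\in C(\Omega)$.
   Context: **Stochastic setting.** $(\Omega,\Sigma,\mathbb{P})$ is a probability space, $\Omega$ is a compact metric space, $\Sigma$ is a complete $\sigma$-algebra containing the Borel sets and such that $C(\Omega)$ is dense in $L^2(\Omega)$. $\mathbb{E}[f]=\int_\Omega f\,d\mathbb{P}$; for $u=u(x,\omega)$, $\mathbb{E}[u](x)=\int_\Omega u(x,\omega)\,d\mathbb{P}(\omega)$. $(T_x)_{x\in\mathbb{R}^3}$ is a family of measurable bijections $T_x:\Omega\to\Omega$ with: $T_0=\mathrm{Id}$, $T_{x+y}=T_x\circ T_y$; $\mathbb{P}(T_x^{-1}(B))=\mathbb{P}(B)$ for all $x\in\mathbb{R}^3$, $B\in\Sigma$; $(x,\omega)\mapsto T_x\omega$ is measurable and continuous from $\mathbb{R}^3\times\Omega$ to $\Omega$; ergodicity: every $A\in\Sigma$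 with $T_xA=A$ up to null sets for all $x$ satisfies $\mathbb{P}(A)\in\{0,1\}$. **Typical trajectories.** For $\rho\in L^1(\Omega)$, $\widetilde\Omega_{\rho\,d\mathbb{P}}$ is the set of $\tilde\omega\in\Omega$ such that $\lim_{t\to\infty}\frac1{t^3|A|}\int_{tA}f(T_x\tilde\omega)\rho(T_x\tilde\omega)\,dx=\mathbb{E}[f\rho]$ for every bounded Borel set $A\subset\mathbb{R}^3$ with $|A|>0$ and every $f\in C(\Omega)$. Given fixed $a,\kappa,M_{\mathrm{sat}}\in L^\infty(\Omega)$ with $0<c_{\mathrm{ex}}\le a\le C_{\mathrm{ex}}$, $|\kappa|\le C_{\mathrm{DMI}}$, $0\le M_{\mathrm{sat}}\le C_{\mathrm{sat}}$ on $\Omega$, $\widetilde\Omega$ is the intersection of the sets $\widetilde\Omega_{\rho\,d\mathbb{P}}$ for $\rho=1,M_{\mathrm{sat}},M_{\mathrm{sat}}^2,a,\kappa,\kappa^2/a$. **Function spaces.** With $\theta(x)=(1+|x|^2)^{-1/2}$, $L^2_\theta(\mathbb{R}^3)=\{u\in\mathcal{D}'(\mathbb{R}^3):u\theta\in L^2(\mathbb{R}^3)\}$ with norm $\|u\theta\|_{L^2}$. $L^2_{\mathrm{loc}}(\mathbb{R}^3\times\Omega)$ denotes functions in $L^2(K\times\Omega)$ for every compact $K\subset\mathbb{R}^3$. *)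

theory Defs
  imports "HOL-Probability.Probability"
begin

type_synonym R3 = "real ^ 3"

definition L2 :: "'a measure \<Rightarrow> ('a \<Rightarrow> real) set" where
  "L2 M = {f \<in> borel_measurable M. integrable M (\<lambda>x. (f x)\<^sup>2)}"

definition L2_nrm :: "'a measure \<Rightarrow> ('a \<Rightarrow> real) \<Rightarrow> real" where
  "L2_nrm M f = sqrt (\<integral>x. (f x)\<^sup>2 \<partial>M)"

definition weight :: "R3 \<Rightarrow> real" where
  "weight x = (1 + (norm x)\<^sup>2) powr (-1/2)"

text \<open>A distribution \<open>u\<close> with \<open>u \<theta> \<in> L\<^sup>2\<close> is a function, since \<open>\<theta>\<close> is smooth and positive;
  hence the weighted space is rendered by functions.\<close>

definition L2_weighted :: "(R3 \<Rightarrow> real) set" where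
  "L2_weighted = {u. (\<lambda>x. u x * weight x) \<in> L2 lebesgue}"

definition L2_weighted_nrm :: "(R3 \<Rightarrow> real) \<Rightarrow> real" where
  "L2_weighted_nrm u = L2_nrm lebesgue (\<lambda>x. u x * weight x)"

text \<open>Every function measurable for the completed product measure agrees almost everywhere with one
  measurable for \<open>lborel \<Otimes>\<^sub>M P\<close>, so nothing is lost by using the latter.\<close>

definition L2_loc :: "'w measure \<Rightarrow> (R3 \<times> 'w \<Rightarrow> real) set" where
  "L2_loc P = {u \<in> borel_measurable (lborel \<Otimes>\<^sub>M P).
     \<forall>K. compact K \<longrightarrow> set_integrable (lborel \<Otimes>\<^sub>M P) (K \<times> space P) (\<lambda>z. (u z)\<^sup>2)}"

primrec Ck :: "nat \<Rightarrow> (R3 \<Rightarrow> real) \<Rightarrow> bool" where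
  "Ck 0 f \<longleftrightarrow> continuous_on UNIV f"
| "Ck (Suc k) f \<longleftrightarrow>
     f differentiable_on UNIV \<and> (\<forall>v. Ck k (\<lambda>x. frechet_derivative f (at x) v))"

definition Cc_smooth :: "(R3 \<Rightarrow> real) set" where
  "Cc_smooth = {\<phi>. (\<forall>k. Ck k \<phi>) \<and> compact (closure {x. \<phi> x \<noteq> 0})}"

text \<open>The compact metric space \<open>\<Omega>\<close> is the whole type \<open>'w\<close>, and \<open>\<Sigma>\<close> is \<open>sets P\<close>.  Joint measurability
  of the flow refers to the completed product measure: for the uncompleted product \<open>\<sigma>\<close>-algebra it
  would fail, because \<open>\<Sigma>\<close> is complete, already for translations on a torus.\<close>

locale stochastic_setting = prob_space P + complete_measure P
  for P :: "'w::metric_space measure" +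
  fixes T :: "R3 \<Rightarrow> 'w \<Rightarrow> 'w"
  assumes space_P: "space P = UNIV"
    and compact_space: "compact (UNIV :: 'w set)"
    and borel_sets: "sets borel \<subseteq> sets P"
    and dense_L2: "\<And>g e. g \<in> L2 P \<Longrightarrow> e > 0 \<Longrightarrow>
      \<exists>f. continuous_on UNIV f \<and> L2_nrm P (\<lambda>\<omega>. g \<omega> - f \<omega>) < e"
    and T_bij: "\<And>x. bij (T x)"
    and T_measurable: "\<And>x. T x \<in> measurable P P"
    and T_zero: "T 0 = id"
    and T_add: "\<And>x y. T (x + y) = T x \<circ> T y"
    and T_preserving: "\<And>x B. B \<in> sets P \<Longrightarrow> emeasure P (T x -` B) = emeasure P B"
    and T_joint_measurable: "(\<lambda>(x, \<omega>). T x \<omega>) \<in> measurable (completion (lborel \<Otimes>\<^sub>M P)) P"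
    and T_joint_continuous: "continuous_on UNIV (\<lambda>(x, \<omega>). T x \<omega>)"
    and T_ergodic: "\<And>A. A \<in> sets P \<Longrightarrow>
      (\<And>x. sym_diff (T x ` A) A \<in> null_sets P) \<Longrightarrow> measure P A \<in> {0, 1}"

text \<open>Integrability of \<open>x \<mapsto> f (T x \<omega>) * \<rho> (T x \<omega>)\<close> on \<open>t A\<close> is required explicitly, as the
  Bochner integral of a non-integrable function is \<open>0\<close> by convention.\<close>

definition typical ::
    "'w::metric_space measure \<Rightarrow> (R3 \<Rightarrow> 'w \<Rightarrow> 'w) \<Rightarrow> ('w \<Rightarrow> real) \<Rightarrow> 'w set" where
  "typical P T \<rho> = {\<omega>. \<forall>A f.
     A \<in> sets borel \<longrightarrow> bounded A \<longrightarrow> measure lebesgue A > 0 \<longrightarrow> continuous_on UNIV f \<longrightarrow>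
       (\<forall>t>0. set_integrable lebesgue ((*\<^sub>R) t ` A) (\<lambda>x. f (T x \<omega>) * \<rho> (T x \<omega>))) \<and>
       ((\<lambda>t. 1 / (t ^ 3 * measure lebesgue A) *
             (LINT x:((*\<^sub>R) t ` A)|lebesgue. f (T x \<omega>) * \<rho> (T x \<omega>)))
          \<longlongrightarrow> (\<integral>\<omega>'. f \<omega>' * \<rho> \<omega>' \<partial>P)) at_top}"

locale coefficients = stochastic_setting P T
  for P :: "'w::metric_space measure" and T :: "R3 \<Rightarrow> 'w \<Rightarrow> 'w" +
  fixes a \<kappa> Msat :: "'w \<Rightarrow> real" and c_ex C_ex C_DMI C_sat :: real
  assumes a_measurable: "a \<in> borel_measurable P"
    and \<kappa>_measurable: "\<kappa> \<in> borel_measurable P"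
    and Msat_measurable: "Msat \<in> borel_measurable P"
    and c_ex_pos: "0 < c_ex"
    and a_bounds: "AE \<omega> in P. c_ex \<le> a \<omega> \<and> a \<omega> \<le> C_ex"
    and \<kappa>_bound: "AE \<omega> in P. \<bar>\<kappa> \<omega>\<bar> \<le> C_DMI"
    and Msat_bounds: "AE \<omega> in P. 0 \<le> Msat \<omega> \<and> Msat \<omega> \<le> C_sat"

definition typical_all ::
    "'w::metric_space measure \<Rightarrow> (R3 \<Rightarrow> 'w \<Rightarrow> 'w) \<Rightarrow> ('w \<Rightarrow> real) \<Rightarrow> ('w \<Rightarrow> real) \<Rightarrow> ('w \<Rightarrow> real)
      \<Rightarrow> 'w set" where
  "typical_all P T a \<kappa> Msat =
     (\<Inter>\<rho> \<in> {\<lambda>_. 1, Msat, \<lambda>\<omega>. (Msat \<omega>)\<^sup>2, a, \<kappa>, \<lambda>\<omega>. (\<kappa> \<omega>)\<^sup>2 / a \<omega>}. typical P T \<rho>)"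

end

theory Submission
  imports Defs "HOL-Complex_Analysis.Great_Picard"
begin

text \<open>Put \<open>v n = u_eps (\<epsilon> n) * weight\<close>, a bounded sequence in \<open>L2 lebesgue\<close>, and consider the pairings
  \<open>\<integral> v n x * \<psi> (x, T (x / \<epsilon> n) \<omega>\<^sub>0) dx\<close> with continuous functions \<open>\<psi>\<close> on \<open>R3 \<times> 'w\<close> whose support
  is bounded in \<open>x\<close>. Three facts carry the proof.

  A subsequence along which all these pairings converge exists, because on functions supported in a
  fixed compact set the pairing is continuous in the supremum norm, uniformly in \<open>n\<close>, and countably
  many step functions span approximations to all of them
  (\<open>sampling_pairing_convergent_subsequence\<close>).

  The limit, as a functional of \<open>\<psi>\<close>, is bounded by the norm of \<open>\<psi>\<close> in \<open>L\<^sup>2\<close> of the product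
  \<open>lborel \<Otimes>\<^sub>M P\<close>. By Cauchy--Schwarz the pairing is at most a constant times
  \<open>(\<integral> (\<psi> (x, T (x / \<epsilon> n) \<omega>\<^sub>0))\<^sup>2 dx)\<close> to the power \<open>1/2\<close>, and on a typical trajectory this integral tends to
  the integral of \<open>\<psi>\<^sup>2\<close> over the product space (\<open>sampled_integral_limit\<close>).

  A bounded functional on a space of test functions is represented by a square integrable function
  \<open>w\<close> (\<open>riesz_on_subspace\<close>). The two-scale limit is then \<open>u (x, \<omega>) = w (x, \<omega>) / weight x\<close>, whose mean
  over \<open>\<omega>\<close> lies in the weighted space by Cauchy--Schwarz on the fibres (\<open>expectation_L2\<close>). It is tested against
  \<open>\<phi> x * b \<omega>\<close> by inserting \<open>\<psi> (x, \<omega>) = \<phi> x / weight x * b \<omega>\<close>.\<close>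

section \<open>Square integrable functions and Riesz representation\<close>

lemma L2_measurable: "f \<in> L2 M \<Longrightarrow> f \<in> borel_measurable M"
  and L2_square_integrable: "f \<in> L2 M \<Longrightarrow> integrable M (\<lambda>x. (f x)\<^sup>2)"
  by (simp_all add: L2_def)

lemma L2_mult_integrable:
  assumes "f \<in> L2 M" "g \<in> L2 M"
  shows "integrable M (\<lambda>x. f x * g x)"
proof (rule Bochner_Integration.integrable_bound)
  show "integrable M (\<lambda>x. (f x)\<^sup>2 + (g x)\<^sup>2)"
    using assms by (simp add: L2_def)
  have [measurable]: "f \<in> borel_measurable M" "g \<in> borel_measurable M"
    using assms by (simp_all add: L2_def)
  show "(\<lambda>x. f x * g x) \<in> borel_measurable M" by measurable
  have "\<bar>f x * g x\<bar> \<le> (f x)\<^sup>2 + (g x)\<^sup>2" for x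
  proof -
    have "2 * (\<bar>f x\<bar> * \<bar>g x\<bar>) \<le> (f x)\<^sup>2 + (g x)\<^sup>2"
      using sum_squares_bound[of "\<bar>f x\<bar>" "\<bar>g x\<bar>"] by simp
    moreover have "0 \<le> \<bar>f x\<bar> * \<bar>g x\<bar>" by simp
    ultimately have "\<bar>f x\<bar> * \<bar>g x\<bar> \<le> (f x)\<^sup>2 + (g x)\<^sup>2" by linarith
    then show ?thesis by (simp add: abs_mult)
  qed
  then show "AE x in M. norm (f x * g x) \<le> norm ((f x)\<^sup>2 + (g x)\<^sup>2)" by simp
qed

lemma L2_add_scaled:
  assumes "f \<in> L2 M" "g \<in> L2 M"
  shows "(\<lambda>x. f x + c * g x) \<in> L2 M"
proof -
  have "integrable M (\<lambda>x. (f x)\<^sup>2 + 2 * c * (f x * g x) + c\<^sup>2 * (g x)\<^sup>2)"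
    using assms L2_mult_integrable[OF assms] by (auto simp: L2_def)
  then have "integrable M (\<lambda>x. (f x + c * g x)\<^sup>2)"
    by (simp add: power2_eq_square algebra_simps)
  moreover have "(\<lambda>x. f x + c * g x) \<in> borel_measurable M"
    using assms[THEN L2_measurable] by measurable
  ultimately show ?thesis by (simp add: L2_def)
qed

lemma L2_diff: "f \<in> L2 M \<Longrightarrow> g \<in> L2 M \<Longrightarrow> (\<lambda>x. f x - g x) \<in> L2 M"
  using L2_add_scaled[of f M g "-1"] by simp

lemma integral_square_add_scaled:
  assumes "f \<in> L2 M" "g \<in> L2 M"
  shows "(\<integral>x. (f x + c * g x)\<^sup>2 \<partial>M) =
    (\<integral>x. (f x)\<^sup>2 \<partial>M) + 2 * c * (\<integral>x. f x * g x \<partial>M) + c\<^sup>2 * (\<integral>x. (g x)\<^sup>2 \<partial>M)"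
proof -
  have "(\<integral>x. (f x + c * g x)\<^sup>2 \<partial>M) =
      (\<integral>x. (f x)\<^sup>2 + 2 * c * (f x * g x) + c\<^sup>2 * (g x)\<^sup>2 \<partial>M)"
    by (simp add: power2_eq_square algebra_simps)
  then show ?thesis
    using assms L2_mult_integrable[OF assms] by (simp add: L2_def)
qed

lemma L2_Cauchy_Schwarz:
  assumes "f \<in> L2 M" "g \<in> L2 M"
  shows "(\<integral>x. f x * g x \<partial>M)\<^sup>2 \<le> (\<integral>x. (f x)\<^sup>2 \<partial>M) * (\<integral>x. (g x)\<^sup>2 \<partial>M)"
proof -
  define D B G where "D = (\<integral>x. (f x)\<^sup>2 \<partial>M)" and "B = (\<integral>x. f x * g x \<partial>M)"
    and "G = (\<integral>x. (g x)\<^sup>2 \<partial>M)"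
  have quad: "0 \<le> D + 2 * c * B + c\<^sup>2 * G" for c
    using integral_square_add_scaled[OF assms, of c] Bochner_Integration.integral_nonneg[of M "\<lambda>x. (f x + c * g x)\<^sup>2"]
    by (simp add: D_def B_def G_def)
  have "G \<ge> 0" by (simp add: G_def)
  show ?thesis
  proof (cases "G = 0")
    case True
    have "B = 0"
    proof (rule ccontr)
      assume "B \<noteq> 0"
      \<comment> \<open>At this point the affine function \<open>D + 2 * c * B\<close> takes the value \<open>-1\<close>.\<close>
      then show False using quad[of "- (D + 1) / (2 * B)"] True by (simp add: field_simps)
    qed
    then show ?thesis using True by (simp add: B_def G_def)
  next
    case False
    then have "G > 0" using \<open>G \<ge> 0\<close> by simp
    then have "B\<^sup>2 \<le> D * G" using quad[of "- B / G"]
      by (simp add: field_simps power2_eq_square)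
    then show ?thesis by (simp add: D_def B_def G_def)
  qed
qed

lemma L2_Cauchy_Schwarz_sqrt:
  assumes "f \<in> L2 M" "g \<in> L2 M"
  shows "\<bar>\<integral>x. f x * g x \<partial>M\<bar> \<le> sqrt (\<integral>x. (f x)\<^sup>2 \<partial>M) * sqrt (\<integral>x. (g x)\<^sup>2 \<partial>M)"
  using real_sqrt_le_mono[OF L2_Cauchy_Schwarz[OF assms]] by (simp add: real_sqrt_mult)

text \<open>A Cauchy condition with geometric rate makes the increments summable almost everywhere, which
  gives a pointwise limit. Fatou's lemma then carries the rate over to that limit, and so shows
  both that the limit is square integrable and that it is the limit in the mean.\<close>

lemma L2_complete:
  fixes f :: "nat \<Rightarrow> 'a \<Rightarrow> real"
  assumes L2: "\<And>n. f n \<in> L2 M"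
    and Cauchy: "\<And>m n. m \<le> n \<Longrightarrow> (\<integral>x. (f m x - f n x)\<^sup>2 \<partial>M) \<le> C * (1/4) ^ m"
  obtains u where "u \<in> L2 M" "\<And>n. (\<integral>x. (f n x - u x)\<^sup>2 \<partial>M) \<le> C * (1/4) ^ n"
proof -
  have [measurable]: "f n \<in> borel_measurable M" for n using L2 by (simp add: L2_def)
  have "0 \<le> (\<integral>x. (f 0 x - f 0 x)\<^sup>2 \<partial>M)" by simp
  then have C0: "C \<ge> 0" using Cauchy[of 0 0] by simp
  define d where "d n x = f (Suc n) x - f n x" for n x
  have [measurable]: "d n \<in> borel_measurable M" for n unfolding d_def by measurable
  have nn_diff: "(\<integral>\<^sup>+x. ennreal ((f m x - f n x)\<^sup>2) \<partial>M) \<le> ennreal (C * (1/4) ^ m)"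
    if "m \<le> n" for m n
  proof -
    have "integrable M (\<lambda>x. (f m x - f n x)\<^sup>2)"
      using L2_diff[OF L2 L2] by (rule L2_square_integrable)
    then show ?thesis using Cauchy[OF that] by (simp add: nn_integral_eq_integral ennreal_leI)
  qed
  \<comment> \<open>The weights \<open>2 ^ n\<close> leave a convergent series of integrals, and yet bound the increments
    pointwise by a geometric sequence.\<close>
  have "(\<integral>\<^sup>+x. (\<Sum>n. ennreal (2 ^ n * (d n x)\<^sup>2)) \<partial>M) = (\<Sum>n. \<integral>\<^sup>+x. ennreal (2 ^ n * (d n x)\<^sup>2) \<partial>M)"
    by (rule nn_integral_suminf) measurable
  also have "\<dots> \<le> (\<Sum>n. ennreal (C * (1/2) ^ n))"
  proof (rule suminf_le)
    fix n
    have "(\<integral>\<^sup>+x. ennreal (2 ^ n * (d n x)\<^sup>2) \<partial>M) = ennreal (2 ^ n) * (\<integral>\<^sup>+x. ennreal ((d n x)\<^sup>2) \<partial>M)"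
      by (simp add: ennreal_mult nn_integral_cmult)
    also have "\<dots> \<le> ennreal (2 ^ n) * ennreal (C * (1/4) ^ n)"
      using nn_diff[of n "Suc n"] by (intro mult_left_mono) (auto simp: d_def power2_commute)
    also have "\<dots> = ennreal (C * (1/2) ^ n)"
    proof -
      have "(2::real) ^ n * (C * (1/4) ^ n) = C * (2 * (1/4)) ^ n"
        by (simp only: power_mult_distrib mult.left_commute)
      then show ?thesis using C0 by (simp flip: ennreal_mult)
    qed
    finally show "(\<integral>\<^sup>+x. ennreal (2 ^ n * (d n x)\<^sup>2) \<partial>M) \<le> ennreal (C * (1/2) ^ n)" .
  qed auto
  also have "\<dots> = ennreal (\<Sum>n. C * (1/2) ^ n)"
    using C0 by (intro suminf_ennreal2) (auto intro!: summable_mult summable_geometric)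
  also have "\<dots> < \<infinity>" by simp
  finally have "AE x in M. (\<Sum>n. ennreal (2 ^ n * (d n x)\<^sup>2)) \<noteq> \<infinity>"
    by (intro nn_integral_PInf_AE) auto
  then have conv: "AE x in M. convergent (\<lambda>n. f n x)"
  proof eventually_elim
    case (elim x)
    define S where "S = (\<Sum>n. ennreal (2 ^ n * (d n x)\<^sup>2))"
    obtain s where s: "S = ennreal s" "s \<ge> 0"
      using elim by (cases S) (auto simp: S_def)
    have bound: "\<bar>d n x\<bar> \<le> sqrt s * (1 / sqrt 2) ^ n" for n
    proof -
      have "(\<Sum>k\<in>{n}. ennreal (2 ^ k * (d k x)\<^sup>2)) \<le> S"
        unfolding S_def by (rule sum_le_suminf) auto
      then have "ennreal (2 ^ n * (d n x)\<^sup>2) \<le> ennreal s"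
        by (simp only: s(1) sum.insert_if finite.emptyI empty_iff if_False sum.empty add_0_right)
      then have "2 ^ n * (d n x)\<^sup>2 \<le> s" using s(2) by (subst (asm) ennreal_le_iff)
      then have "sqrt (2 ^ n * (d n x)\<^sup>2) \<le> sqrt s" by (rule real_sqrt_le_mono)
      then have "sqrt 2 ^ n * \<bar>d n x\<bar> \<le> sqrt s"
        by (simp add: real_sqrt_mult real_sqrt_power[of 2])
      then show ?thesis by (simp add: power_divide pos_le_divide_eq mult.commute)
    qed
    have "summable (\<lambda>n. d n x)"
      by (rule summable_comparison_test'[of "\<lambda>n. sqrt s * (1 / sqrt 2) ^ n" 0])
        (use bound in \<open>auto intro!: summable_mult summable_geometric\<close>)
    then have "convergent (\<lambda>n. (\<Sum>i<n. d i x))"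
      by (simp add: summable_iff_convergent)
    then have "convergent (\<lambda>n. f 0 x + (\<Sum>i<n. d i x))"
      by (intro convergent_add convergent_const)
    moreover have "f 0 x + (\<Sum>i<n. d i x) = f n x" for n
      by (induction n) (auto simp: d_def)
    ultimately show ?case by simp
  qed
  define u where "u x = lim (\<lambda>n. f n x)" for x
  have [measurable]: "u \<in> borel_measurable M" unfolding u_def by measurable
  have nn_lim: "(\<integral>\<^sup>+x. ennreal ((f m x - u x)\<^sup>2) \<partial>M) \<le> ennreal (C * (1/4) ^ m)" for m
  proof -
    have "(\<integral>\<^sup>+x. ennreal ((f m x - u x)\<^sup>2) \<partial>M) =
        (\<integral>\<^sup>+x. liminf (\<lambda>n. ennreal ((f m x - f n x)\<^sup>2)) \<partial>M)"
    proof (rule nn_integral_cong_AE, use conv in eventually_elim)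
      case (elim x)
      then have "(\<lambda>n. f n x) \<longlonglongrightarrow> u x" by (simp add: u_def convergent_LIMSEQ_iff)
      then have "(\<lambda>n. ennreal ((f m x - f n x)\<^sup>2)) \<longlonglongrightarrow> ennreal ((f m x - u x)\<^sup>2)"
        by (intro tendsto_intros)
      then show ?case by (intro lim_imp_Liminf[symmetric]) auto
    qed
    also have "\<dots> \<le> liminf (\<lambda>n. \<integral>\<^sup>+x. ennreal ((f m x - f n x)\<^sup>2) \<partial>M)"
      by (rule nn_integral_liminf) measurable
    also have "\<dots> \<le> ennreal (C * (1/4) ^ m)"
    proof (rule Liminf_le)
      show "\<forall>\<^sub>F n in sequentially. (\<integral>\<^sup>+x. ennreal ((f m x - f n x)\<^sup>2) \<partial>M) \<le> ennreal (C * (1/4) ^ m)"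
        by (rule eventually_sequentiallyI[of m]) (rule nn_diff)
    qed simp
    finally show ?thesis .
  qed
  have diffL2: "(\<lambda>x. f m x - u x) \<in> L2 M" for m
    using nn_lim[of m] unfolding L2_def
    by (auto simp: integrable_iff_bounded intro: le_less_trans)
  show thesis
  proof
    show "u \<in> L2 M" using L2_diff[OF L2[of 0] diffL2[of 0]] by simp
    show "(\<integral>x. (f n x - u x)\<^sup>2 \<partial>M) \<le> C * (1/4) ^ n" for n
      using nn_lim[of n] C0 L2_square_integrable[OF diffL2[of n]]
      by (simp add: nn_integral_eq_integral ennreal_le_iff)
  qed
qed

text \<open>The Riesz representation theorem, by the direct method: a sequence in \<open>V\<close> that minimises
  \<open>\<integral> f\<^sup>2 - 2 * F f\<close> is Cauchy, by the parallelogram identity, and its limit satisfies the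
  Euler--Lagrange equation of the functional, which says that it represents \<open>F\<close>. The representing
  function is taken in \<open>L2 M\<close>, so that \<open>V\<close> may consist of continuous functions only.\<close>

lemma riesz_on_subspace:
  assumes V0: "V \<noteq> {}" and VL2: "V \<subseteq> L2 M"
    and V_lin: "\<And>f g c. f \<in> V \<Longrightarrow> g \<in> V \<Longrightarrow> (\<lambda>x. f x + c * g x) \<in> V"
    and F_lin: "\<And>f g c. f \<in> V \<Longrightarrow> g \<in> V \<Longrightarrow> F (\<lambda>x. f x + c * g x) = F f + c * F g"
    and F_bd: "\<And>f. f \<in> V \<Longrightarrow> \<bar>F f\<bar> \<le> C * sqrt (\<integral>x. (f x)\<^sup>2 \<partial>M)"
  obtains w where "w \<in> L2 M" "\<And>f. f \<in> V \<Longrightarrow> F f = (\<integral>x. w x * f x \<partial>M)"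
proof -
  define J where "J f = (\<integral>x. (f x)\<^sup>2 \<partial>M) - 2 * F f" for f
  define m where "m = Inf (J ` V)"
  have J_ge: "- C\<^sup>2 \<le> J f" if "f \<in> V" for f
  proof -
    define s where "s = sqrt (\<integral>x. (f x)\<^sup>2 \<partial>M)"
    have "s\<^sup>2 = (\<integral>x. (f x)\<^sup>2 \<partial>M)" by (simp add: s_def)
    moreover have "F f \<le> C * s" using F_bd[OF that] by (simp add: s_def)
    moreover have "0 \<le> (s - C)\<^sup>2" by simp
    ultimately show ?thesis by (simp add: J_def power2_eq_square algebra_simps)
  qed
  have m_le: "m \<le> J f" if "f \<in> V" for f
    unfolding m_def using that J_ge by (intro cInf_lower) (auto intro!: bdd_belowI2)
  have "\<exists>f\<in>V. J f < m + (1/4) ^ k" for k :: nat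
  proof -
    have "\<exists>y\<in>J ` V. y < m + (1/4) ^ k"
      unfolding m_def using V0 by (intro cInf_lessD) auto
    then show ?thesis by auto
  qed
  then obtain f where fV: "\<And>k. f k \<in> V" and fJ: "\<And>k. J (f k) < m + (1/4) ^ k"
    by metis
  note fL2 = subsetD[OF VL2 fV]
  have J_add: "J (\<lambda>x. g x + c * h x) = J g + 2 * c * ((\<integral>x. g x * h x \<partial>M) - F h) + c\<^sup>2 * (\<integral>x. (h x)\<^sup>2 \<partial>M)"
    if "g \<in> V" "h \<in> V" for g h c
    using integral_square_add_scaled[of g M h c] F_lin[OF that, of c] VL2 that
    by (auto simp: J_def algebra_simps)
  have par: "(\<integral>x. (f i x - f j x)\<^sup>2 \<partial>M) \<le> 4 * (1/4) ^ i" if "i \<le> j" for i j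
  proof -
    \<comment> \<open>The parallelogram identity, expanded around \<open>f i\<close>: with \<open>h = f j - f i\<close>, compare \<open>J\<close> at
      \<open>f i + h\<close> and at the midpoint \<open>f i + h / 2\<close>.\<close>
    define h where "h x = f j x - f i x" for x
    have hV: "h \<in> V" using V_lin[OF fV fV, of j "-1" i] by (simp add: h_def[abs_def])
    define q where "q n = (1/4::real) ^ n" for n :: nat
    have "J (f j) = J (f i) + 2 * ((\<integral>x. f i x * h x \<partial>M) - F h) + (\<integral>x. (h x)\<^sup>2 \<partial>M)"
      using J_add[OF fV hV, of i 1] by (simp add: h_def)
    moreover have "m \<le> J (f i) + ((\<integral>x. f i x * h x \<partial>M) - F h) + (\<integral>x. (h x)\<^sup>2 \<partial>M) / 4"
      using J_add[OF fV hV, of i "1/2"] m_le[OF V_lin[OF fV hV, of i "1/2"]]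
      by (simp add: power2_eq_square)
    moreover have "(1/4) ^ j \<le> (1/4::real) ^ i" using that by (intro power_decreasing) auto
    ultimately have "(\<integral>x. (h x)\<^sup>2 \<partial>M) \<le> 4 * (1/4) ^ i"
      using fJ[of i] fJ[of j] unfolding q_def[symmetric] by argo
    then show ?thesis by (simp add: h_def power2_commute)
  qed
  obtain w where w: "w \<in> L2 M" "\<And>n. (\<integral>x. (f n x - w x)\<^sup>2 \<partial>M) \<le> 4 * (1/4) ^ n"
    using L2_complete[of f M 4, OF fL2 par] by blast
  have "F g = (\<integral>x. w x * g x \<partial>M)" if gV: "g \<in> V" for g
  proof -
    note gL2 = subsetD[OF VL2 gV]
    define G where "G = (\<integral>x. (g x)\<^sup>2 \<partial>M)"
    have lim: "(\<lambda>k. \<integral>x. f k x * g x \<partial>M) \<longlonglongrightarrow> (\<integral>x. w x * g x \<partial>M)"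
    proof (rule LIM_zero_cancel, rule Lim_null_comparison)
      show "(\<lambda>k. sqrt (4 * (1/4) ^ k) * sqrt G) \<longlonglongrightarrow> 0"
        by (auto intro!: tendsto_eq_intros LIMSEQ_power_zero)
      have "\<bar>(\<integral>x. f k x * g x \<partial>M) - (\<integral>x. w x * g x \<partial>M)\<bar> \<le> sqrt (4 * (1/4) ^ k) * sqrt G" for k
      proof -
        have "(\<integral>x. f k x * g x \<partial>M) - (\<integral>x. w x * g x \<partial>M) = (\<integral>x. (f k x - w x) * g x \<partial>M)"
          using L2_mult_integrable[OF fL2 gL2] L2_mult_integrable[OF w(1) gL2]
          by (simp add: left_diff_distrib)
        also have "\<bar>\<dots>\<bar> \<le> sqrt (\<integral>x. (f k x - w x)\<^sup>2 \<partial>M) * sqrt G"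
          unfolding G_def by (rule L2_Cauchy_Schwarz_sqrt[OF L2_diff[OF fL2 w(1)] gL2])
        also have "\<dots> \<le> sqrt (4 * (1/4) ^ k) * sqrt G"
          using w(2)[of k] by (intro mult_right_mono real_sqrt_le_mono) (auto simp: G_def)
        finally show ?thesis .
      qed
      then show "\<forall>\<^sub>F k in sequentially. norm ((\<integral>x. f k x * g x \<partial>M) - (\<integral>x. w x * g x \<partial>M)) \<le> sqrt (4 * (1/4) ^ k) * sqrt G"
        by simp
    qed
    define e where "e = (\<integral>x. w x * g x \<partial>M) - F g"
    \<comment> \<open>Minimality in the direction \<open>g\<close>: the limit of \<open>m \<le> J (f k + c * g)\<close>, where \<open>e\<close> is the
      derivative that has to vanish.\<close>
    have quad: "0 \<le> 2 * c * e + c\<^sup>2 * G" for c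
    proof (rule LIMSEQ_le)
      show "(\<lambda>k. 0) \<longlonglongrightarrow> (0::real)" by simp
      show "(\<lambda>k. (1/4) ^ k + 2 * c * ((\<integral>x. f k x * g x \<partial>M) - F g) + c\<^sup>2 * G)
          \<longlonglongrightarrow> 2 * c * e + c\<^sup>2 * G"
        unfolding e_def by (rule tendsto_eq_intros lim LIMSEQ_power_zero refl | simp)+
      have "0 \<le> (1/4) ^ k + 2 * c * ((\<integral>x. f k x * g x \<partial>M) - F g) + c\<^sup>2 * G" for k
        using J_add[OF fV gV, of k c] m_le[OF V_lin[OF fV gV, of k c]] fJ[of k]
        by (simp add: G_def)
      then show "\<exists>N. \<forall>k\<ge>N. 0 \<le> (1/4) ^ k + 2 * c * ((\<integral>x. f k x * g x \<partial>M) - F g) + c\<^sup>2 * G"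
        by blast
    qed
    have "e = 0"
    proof -
      have "G \<ge> 0" by (simp add: G_def)
      define c where "c = - e / (G + 1)"
      have ce: "c * (G + 1) = - e" using \<open>G \<ge> 0\<close> by (simp add: c_def)
      have "0 \<le> (2 * c * e + c\<^sup>2 * G) * (G + 1)\<^sup>2"
        using quad[of c] by simp
      also have "\<dots> = 2 * (c * (G + 1)) * e * (G + 1) + (c * (G + 1))\<^sup>2 * G"
        by (simp add: power2_eq_square algebra_simps)
      also have "\<dots> = - (e * e * (G + 2))"
        unfolding ce by (simp add: power2_eq_square algebra_simps)
      finally have "e * e * (G + 2) \<le> 0" by simp
      then show ?thesis using \<open>G \<ge> 0\<close> by (auto simp: mult_le_0_iff)
    qed
    then show ?thesis by (simp add: e_def)
  qed
  with w(1) show thesis using that by blast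
qed

section \<open>Borel partitions and convergent subsequences of pairings\<close>

text \<open>Functions that are uniformly continuous on \<open>K\<close> are uniformly close to functions that are
  constant on the pieces of such a partition. Borel pieces suffice for this and, unlike a
  partition of unity, make the approximating functions finite sums over disjoint sets.\<close>

lemma compact_finite_borel_partition:
  fixes K :: "'a::metric_space set"
  assumes "compact K" "\<delta> > 0"
  obtains C Q where "finite C" "C \<subseteq> K" "\<And>c. Q c \<in> sets borel"
    "\<And>c. Q c \<subseteq> K \<inter> ball c \<delta>" "disjoint_family_on Q C" "K = (\<Union>c\<in>C. Q c)"
proof -
  obtain C where C: "finite C" "C \<subseteq> K" "K \<subseteq> (\<Union>c\<in>C. ball c \<delta>)"
    using compactE_image[of K K "\<lambda>c. ball c \<delta>"] assms by (metis UN_I centre_in_ball open_ball subsetI)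
  obtain i :: "'a \<Rightarrow> nat" where i: "inj_on i C"
    using C(1) finite_imp_inj_to_nat_seg by metis
  define Q where "Q c = K \<inter> ball c \<delta> - (\<Union>c'\<in>{c'\<in>C. i c' < i c}. ball c' \<delta>)" for c
  show thesis
  proof
    show "finite C" "C \<subseteq> K" by fact+
    have "K \<in> sets borel" using assms by (simp add: borel_closed compact_imp_closed)
    then show "Q c \<in> sets borel" for c
      unfolding Q_def using C(1) by (intro sets.Diff sets.Int sets.finite_UN) auto
    show "Q c \<subseteq> K \<inter> ball c \<delta>" for c by (auto simp: Q_def)
    have "Q c \<inter> Q c' = {}" if "c \<in> C" "c' \<in> C" "c \<noteq> c'" for c c'
    proof -
      have "i c < i c' \<or> i c' < i c" using i that by (metis inj_onD nat_neq_iff)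
      then show ?thesis using that(1,2) unfolding Q_def by blast
    qed
    then show "disjoint_family_on Q C" by (auto simp: disjoint_family_on_def)
    have "\<exists>c\<in>C. x \<in> Q c" if "x \<in> K" for x
    proof -
      have ex: "\<exists>c. c \<in> C \<and> x \<in> ball c \<delta>" using subsetD[OF C(3) that] by blast
      define c where "c = (ARG_MIN i c. c \<in> C \<and> x \<in> ball c \<delta>)"
      have "c \<in> C \<and> x \<in> ball c \<delta>" "\<And>c'. c' \<in> C \<and> x \<in> ball c' \<delta> \<Longrightarrow> i c \<le> i c'"
        using ex arg_min_nat_lemma[of "\<lambda>c. c \<in> C \<and> x \<in> ball c \<delta>" _ i] unfolding c_def by blast+
      then have "c \<in> C" "x \<in> Q c" unfolding Q_def using that by (auto simp: not_less)
      then show ?thesis by blast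
    qed
    then show "K = (\<Union>c\<in>C. Q c)" by (auto simp: Q_def)
  qed
qed

lemma sum_indicator_partition:
  fixes g :: "'c \<Rightarrow> real"
  assumes "finite C" "disjoint_family_on Q C" "c \<in> C" "x \<in> Q c"
  shows "(\<Sum>c'\<in>C. g c' * indicator (Q c') x) = g c"
proof -
  have "(\<Sum>c'\<in>C. g c' * indicator (Q c') x) = (\<Sum>c'\<in>C. if c' = c then g c else 0)"
    using assms by (intro sum.cong) (auto simp: disjoint_family_on_def indicator_def)
  then show ?thesis using assms by simp
qed

text \<open>A bound by the supremum of \<open>g\<close> only; it does not see the distribution of the
  samples \<open>h x\<close>, and therefore also applies to the discontinuous indicator functions used to
  extract a subsequence.\<close>

lemma sampling_pairing_bound:
  fixes g :: "'z::metric_space \<Rightarrow> real"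
  assumes v: "v \<in> L2 M" "(\<integral>x. (v x)\<^sup>2 \<partial>M) \<le> c\<^sup>2" "c \<ge> 0"
    and h: "h \<in> M \<rightarrow>\<^sub>M borel" and K: "K \<in> sets borel"
    and fin: "emeasure M (h -` K \<inter> space M) \<le> ennreal B" "B \<ge> 0"
    and g: "g \<in> borel_measurable borel" "\<And>z. \<bar>g z\<bar> \<le> s * indicator K z" "s \<ge> 0"
  shows "(\<lambda>x. g (h x)) \<in> L2 M" "\<bar>\<integral>x. v x * g (h x) \<partial>M\<bar> \<le> s * (c * sqrt B)"
proof -
  define A where "A = h -` K \<inter> space M"
  have A: "A \<in> sets M" using h K unfolding A_def by (rule measurable_sets)
  have finA: "emeasure M A < \<infinity>" using fin by (auto simp: A_def intro: le_less_trans)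
  have mA: "measure M A \<le> B"
    using fin finA by (simp add: A_def measure_def enn2real_leI)
  have sq: "(g (h x))\<^sup>2 \<le> s\<^sup>2 * indicator A x" if "x \<in> space M" for x
    using power_mono[OF g(2)[of "h x"], of 2] that
    by (cases "h x \<in> K") (auto simp: A_def)
  have [measurable]: "(\<lambda>x. g (h x)) \<in> borel_measurable M"
    using measurable_compose[OF h g(1)] .
  have int: "integrable M (\<lambda>x. s\<^sup>2 * indicator A x)" using A finA by simp
  have int2: "integrable M (\<lambda>x. (g (h x))\<^sup>2)"
    by (rule Bochner_Integration.integrable_bound[OF int]) (use sq in auto)
  show L2: "(\<lambda>x. g (h x)) \<in> L2 M" using int2 by (simp add: L2_def)
  have "(\<integral>x. (g (h x))\<^sup>2 \<partial>M) \<le> (\<integral>x. s\<^sup>2 * indicator A x \<partial>M)"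
    by (rule integral_mono[OF int2 int sq])
  also have "\<dots> = s\<^sup>2 * measure M A" using A finA by simp
  also have "\<dots> \<le> s\<^sup>2 * B" using mA by (simp add: mult_left_mono)
  finally have g2: "sqrt (\<integral>x. (g (h x))\<^sup>2 \<partial>M) \<le> s * sqrt B"
    using g(3) real_sqrt_le_mono by (fastforce simp: real_sqrt_mult)
  have v2: "sqrt (\<integral>x. (v x)\<^sup>2 \<partial>M) \<le> c" using v by (simp add: real_le_lsqrt)
  have "\<bar>\<integral>x. v x * g (h x) \<partial>M\<bar> \<le> sqrt (\<integral>x. (v x)\<^sup>2 \<partial>M) * sqrt (\<integral>x. (g (h x))\<^sup>2 \<partial>M)"
    by (rule L2_Cauchy_Schwarz_sqrt[OF v(1) L2])
  also have "\<dots> \<le> c * (s * sqrt B)" using v2 g2 v(3) by (intro mult_mono) auto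
  finally show "\<bar>\<integral>x. v x * g (h x) \<partial>M\<bar> \<le> s * (c * sqrt B)" by (simp add: mult_ac)
qed

text \<open>The diagonal argument. The indicators of the pieces of countably many partitions of the compact
  sets \<open>K N\<close> form a countable family, along which a common subsequence converges. By uniform
  continuity every admissible \<open>\<psi>\<close> is a uniform limit of their linear combinations, so the crude
  supremum bound transfers convergence to \<open>\<psi>\<close>.\<close>

lemma sampling_pairing_convergent_subsequence:
  fixes h :: "nat \<Rightarrow> 'a \<Rightarrow> 'z::metric_space" and K :: "nat \<Rightarrow> 'z set"
  assumes v: "\<And>n. v n \<in> L2 M" "\<And>n. (\<integral>x. (v n x)\<^sup>2 \<partial>M) \<le> c\<^sup>2" "c \<ge> 0"
    and h: "\<And>n. h n \<in> M \<rightarrow>\<^sub>M borel" and K: "\<And>N. compact (K N)"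
    and fin: "\<And>N n. emeasure M (h n -` K N \<inter> space M) \<le> ennreal (B N)" "\<And>N. B N \<ge> 0"
  shows "\<exists>r :: nat \<Rightarrow> nat. strict_mono r \<and>
    (\<forall>N \<psi>. continuous_on UNIV \<psi> \<longrightarrow> (\<forall>z. z \<notin> K N \<longrightarrow> \<psi> z = 0) \<longrightarrow>
      convergent (\<lambda>n. \<integral>x. v (r n) x * \<psi> (h (r n) x) \<partial>M))"
proof -
  have K_borel: "K N \<in> sets borel" for N using K by (simp add: borel_closed compact_imp_closed)
  have "\<exists>C Q. finite C \<and> C \<subseteq> K N \<and> (\<forall>c. Q c \<in> sets borel) \<and>
      (\<forall>c. Q c \<subseteq> K N \<inter> ball c (1 / real (Suc m))) \<and> disjoint_family_on Q C \<and> K N = (\<Union>c\<in>C. Q c)"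
    for N m
    by (rule compact_finite_borel_partition[OF K[of N], of "1 / real (Suc m)"]) auto
  then obtain C Q where C: "\<And>N m. finite (C N m)" "\<And>N m. C N m \<subseteq> K N"
    and Q: "\<And>N m c. Q N m c \<in> sets borel"
      "\<And>N m c. Q N m c \<subseteq> K N \<inter> ball c (1 / real (Suc m))"
      "\<And>N m. disjoint_family_on (Q N m) (C N m)" "\<And>N m. K N = (\<Union>c\<in>C N m. Q N m c)"
    by metis
  define b where "b N = c * sqrt (B N)" for N
  have b0: "b N \<ge> 0" for N using v(3) fin(2) by (simp add: b_def)
  have bound: "\<bar>\<integral>x. v n x * g (h n x) \<partial>M\<bar> \<le> s * b N" and gL2: "(\<lambda>x. g (h n x)) \<in> L2 M"
    if "g \<in> borel_measurable borel" "\<And>z. \<bar>g z\<bar> \<le> s * indicator (K N) z" "s \<ge> 0" for n g s N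
    using sampling_pairing_bound[OF v(1) v(2) v(3) h K_borel fin that] by (simp_all add: b_def)
  define p where "p n N m c = (\<integral>x. v n x * indicator (Q N m c) (h n x) \<partial>M)" for n N m c
  have indK: "\<bar>indicator (Q N m c) z\<bar> \<le> 1 * (indicator (K N) z :: real)" for N m c z
    using Q(2)[of N m c] by (auto simp: indicator_def)
  have ind_meas: "(indicator (Q N m c) :: 'z \<Rightarrow> real) \<in> borel_measurable borel" for N m c
    using Q(1) by (rule borel_measurable_indicator)
  define S where "S = (SIGMA N:UNIV. SIGMA m:UNIV. C N m)"
  have "countable S" unfolding S_def
    by (intro countable_SIGMA) (auto intro: countable_finite C)
  moreover have "norm (case t of (N, m, c) \<Rightarrow> p n N m c / (b N + 1)) \<le> 1" if "t \<in> S" for n t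
  proof -
    obtain N m c where t: "t = (N, m, c)" by (cases t)
    have "\<bar>p n N m c\<bar> \<le> b N" unfolding p_def
      using bound[OF ind_meas indK, of n N m c] by simp
    then show ?thesis using b0[of N] by (simp add: t)
  qed
  ultimately obtain r :: "nat \<Rightarrow> nat" where r: "strict_mono r"
    "\<And>t. t \<in> S \<Longrightarrow> \<exists>l. (\<lambda>n. case t of (N, m, c) \<Rightarrow> p (r n) N m c / (b N + 1)) \<longlonglongrightarrow> l"
    using function_convergent_subsequence[of S "\<lambda>n t. case t of (N, m, c) \<Rightarrow> p n N m c / (b N + 1)" 1]
    by blast
  have p_conv: "convergent (\<lambda>n. p (r n) N m c)" if c: "c \<in> C N m" for N m c
  proof -
    have "(N, m, c) \<in> S" using c by (simp add: S_def)
    from r(2)[OF this] have "convergent (\<lambda>n. p (r n) N m c / (b N + 1))"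
      by (auto simp: convergent_def)
    then have "convergent (\<lambda>n. (b N + 1) * (p (r n) N m c / (b N + 1)))"
      by (intro convergent_mult convergent_const)
    then show ?thesis using b0[of N] by (simp add: add_nonneg_eq_0_iff)
  qed
  have "convergent (\<lambda>n. \<integral>x. v (r n) x * \<psi> (h (r n) x) \<partial>M)"
    if cont: "continuous_on UNIV \<psi>" and supp: "\<And>z. z \<notin> K N \<Longrightarrow> \<psi> z = 0" for N \<psi>
  proof -
    define a where "a n = (\<integral>x. v n x * \<psi> (h n x) \<partial>M)" for n
    have \<psi>_meas: "\<psi> \<in> borel_measurable borel" using cont by (rule borel_measurable_continuous_onI)
    have approx: "\<exists>s. convergent (\<lambda>n. s (r n)) \<and> (\<forall>n. \<bar>a n - s n\<bar> \<le> e)" if e: "e > 0" for e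
    proof -
      define \<eta> where "\<eta> = e / (b N + 1)"
      have \<eta>: "\<eta> > 0" "\<eta> * b N \<le> e"
        using e b0[of N] by (auto simp: \<eta>_def field_simps add_nonneg_pos)
      have "uniformly_continuous_on (K N) \<psi>"
        using cont K by (blast intro: compact_uniformly_continuous continuous_on_subset)
      then obtain \<delta> where \<delta>: "\<delta> > 0"
        "\<And>y z. y \<in> K N \<Longrightarrow> z \<in> K N \<Longrightarrow> dist z y < \<delta> \<Longrightarrow> dist (\<psi> z) (\<psi> y) < \<eta>"
        using \<eta>(1) unfolding uniformly_continuous_on_def by meson
      obtain m where m: "1 / real (Suc m) < \<delta>" using nat_approx_posE[OF \<delta>(1)] by auto
      define \<sigma> where "\<sigma> z = (\<Sum>c\<in>C N m. \<psi> c * indicator (Q N m c) z)" for z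
      define s where "s n = (\<Sum>c\<in>C N m. \<psi> c * p n N m c)" for n
      have \<sigma>_meas: "\<sigma> \<in> borel_measurable borel"
        unfolding \<sigma>_def using ind_meas by measurable
      have close: "\<bar>\<psi> z - \<sigma> z\<bar> \<le> \<eta> * indicator (K N) z" for z
      proof (cases "z \<in> K N")
        case True
        then obtain c where c: "c \<in> C N m" "z \<in> Q N m c" using Q(4)[of N m] by blast
        have "\<sigma> z = \<psi> c"
          unfolding \<sigma>_def by (rule sum_indicator_partition[OF C(1) Q(3) c])
        moreover have "dist z c < \<delta>" using c(2) Q(2)[of N m c] m by (auto simp: dist_commute)
        ultimately show ?thesis using \<delta>(2)[of c z] True c(1) C(2)[of N m]
          by (auto simp: dist_real_def less_imp_le)
      next
        case False
        then have "z \<notin> Q N m c" for c using Q(2)[of N m c] by blast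
        then show ?thesis using False supp by (simp add: \<sigma>_def)
      qed
      have "a n - s n = (\<integral>x. v n x * (\<psi> (h n x) - \<sigma> (h n x)) \<partial>M)" for n
      proof -
        have i1: "integrable M (\<lambda>x. v n x * indicator (Q N m c) (h n x))" for c
          by (rule L2_mult_integrable[OF v(1) gL2[OF ind_meas indK]]) auto
        have i2: "integrable M (\<lambda>x. v n x * (\<psi> (h n x) - \<sigma> (h n x)))"
          by (rule L2_mult_integrable[OF v(1) gL2[OF borel_measurable_diff[OF \<psi>_meas \<sigma>_meas] close]])
            (use \<eta> in auto)
        have "s n = (\<integral>x. (\<Sum>c\<in>C N m. \<psi> c * (v n x * indicator (Q N m c) (h n x))) \<partial>M)"
          unfolding s_def p_def using i1 by simp
        also have "\<dots> = (\<integral>x. v n x * \<sigma> (h n x) \<partial>M)"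
          unfolding \<sigma>_def by (simp add: sum_distrib_left mult_ac)
        finally have s_eq: "s n = (\<integral>x. v n x * \<sigma> (h n x) \<partial>M)" .
        have i3: "integrable M (\<lambda>x. v n x * \<sigma> (h n x))"
          unfolding \<sigma>_def sum_distrib_left mult.left_commute[of "v n _"] using i1 by simp
        have "a n = (\<integral>x. v n x * (\<psi> (h n x) - \<sigma> (h n x)) + v n x * \<sigma> (h n x) \<partial>M)"
          unfolding a_def by (simp add: algebra_simps)
        then show ?thesis using i2 i3 s_eq by simp
      qed
      moreover have "\<bar>\<integral>x. v n x * (\<psi> (h n x) - \<sigma> (h n x)) \<partial>M\<bar> \<le> \<eta> * b N" for n
        by (rule bound[OF borel_measurable_diff[OF \<psi>_meas \<sigma>_meas] close]) (use \<eta> in auto)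
      ultimately have "\<bar>a n - s n\<bar> \<le> e" for n using \<eta>(2) by (metis order_trans)
      moreover have "convergent (\<lambda>n. s (r n))"
        unfolding s_def using p_conv by (intro convergent_sum convergent_mult convergent_const) auto
      ultimately show ?thesis by blast
    qed
    have "Cauchy (\<lambda>n. a (r n))"
    proof (rule metric_CauchyI)
      fix e :: real assume "e > 0"
      then obtain s where s: "convergent (\<lambda>n. s (r n))" "\<And>n. \<bar>a n - s n\<bar> \<le> e / 4"
        using approx[of "e / 4"] by auto
      then obtain n0 where n0: "\<And>m n. m \<ge> n0 \<Longrightarrow> n \<ge> n0 \<Longrightarrow> dist (s (r m)) (s (r n)) < e / 2"
        using metric_CauchyD[OF convergent_Cauchy, of "\<lambda>n. s (r n)" "e / 2"] \<open>e > 0\<close> by auto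
      have "dist (a (r m)) (a (r n)) < e" if "m \<ge> n0" "n \<ge> n0" for m n
        using n0[OF that] s(2)[of "r m"] s(2)[of "r n"] unfolding dist_real_def by linarith
      then show "\<exists>n0. \<forall>m\<ge>n0. \<forall>n\<ge>n0. dist (a (r m)) (a (r n)) < e" by blast
    qed
    then show ?thesis by (simp add: Cauchy_convergent_iff a_def)
  qed
  with r(1) show ?thesis by blast
qed

section \<open>Test functions on the product space\<close>

text \<open>Not only the products \<open>\<phi> x * b \<omega>\<close>: this class is a vector space that is closed under squares, so the
  ergodic limit of the square of a test function is an instance of the ergodic limit of a test
  function. Bounded support in \<open>x\<close> amounts to compact support, since \<open>\<omega>\<close> will range over a compact space.\<close>

definition test_functions :: "(R3 \<times> 'w::metric_space \<Rightarrow> real) set" where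
  "test_functions = {\<psi>. continuous_on UNIV \<psi> \<and>
     (\<exists>N::nat. \<forall>x \<omega>. x \<notin> cball 0 (real N) \<longrightarrow> \<psi> (x, \<omega>) = 0)}"

lemma test_functions_continuous: "\<psi> \<in> test_functions \<Longrightarrow> continuous_on UNIV \<psi>"
  by (simp add: test_functions_def)

lemma test_functions_square: "\<psi> \<in> test_functions \<Longrightarrow> (\<lambda>z. (\<psi> z)\<^sup>2) \<in> test_functions"
  by (auto simp: test_functions_def intro!: continuous_intros)

lemma test_functions_add_scaled:
  assumes "\<psi> \<in> test_functions" "\<psi>' \<in> test_functions"
  shows "(\<lambda>z. \<psi> z + c * \<psi>' z) \<in> test_functions"
proof -
  obtain N N' :: nat where "\<And>x \<omega>. x \<notin> cball 0 (real N) \<Longrightarrow> \<psi> (x, \<omega>) = 0"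
    "\<And>x \<omega>. x \<notin> cball 0 (real N') \<Longrightarrow> \<psi>' (x, \<omega>) = 0"
    using assms unfolding test_functions_def by blast
  then have "\<forall>x \<omega>. x \<notin> cball 0 (real (max N N')) \<longrightarrow> \<psi> (x, \<omega>) + c * \<psi>' (x, \<omega>) = 0"
    by auto
  then show ?thesis using assms unfolding test_functions_def
    by (auto intro!: continuous_intros)
qed

context stochastic_setting
begin

lemma pair_sigma_finite_lborel: "pair_sigma_finite lborel P"
  by (simp add: pair_sigma_finite_def sigma_finite_measure_axioms lborel.sigma_finite_measure_axioms)

lemma continuous_measurable: "continuous_on UNIV b \<Longrightarrow> (b :: 'w \<Rightarrow> real) \<in> borel_measurable P"
  using borel_sets space_P borel_measurable_continuous_onI[of b]
  by (auto simp: measurable_def)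

lemma continuous_bounded:
  assumes "continuous_on UNIV (b :: 'w \<Rightarrow> real)"
  obtains B where "\<And>\<omega>. \<bar>b \<omega>\<bar> \<le> B"
proof -
  have "bounded (range b)"
    using assms compact_space by (blast intro: compact_imp_bounded compact_continuous_image)
  then show thesis using that unfolding bounded_iff by auto
qed

lemma continuous_integrable: "continuous_on UNIV b \<Longrightarrow> integrable P (b :: 'w \<Rightarrow> real)"
  using continuous_measurable[of b] continuous_bounded[of b]
  by (metis integrable_const_bound AE_I2 real_norm_def)

lemma trajectory_continuous: "continuous_on UNIV (\<lambda>x. T (c *\<^sub>R x) \<omega>)"
proof -
  have "continuous_on UNIV ((\<lambda>(x, \<omega>). T x \<omega>) \<circ> (\<lambda>x. (c *\<^sub>R x, \<omega>)))"
    by (rule continuous_on_compose)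
      (auto intro!: continuous_intros continuous_on_subset[OF T_joint_continuous])
  then show ?thesis by (simp add: o_def)
qed

lemma emeasure_cylinder:
  assumes "A \<in> sets lborel"
  shows "emeasure (lborel \<Otimes>\<^sub>M P) (A \<times> UNIV) = emeasure lborel A"
  using emeasure_pair_measure_Times[of A lborel UNIV] assms emeasure_space_1 space_P sets.top[of P]
  by simp

text \<open>Freezing \<open>x\<close> at finitely many points, while \<open>\<omega>\<close> stays free, reduces statements on test functions to
  products of an indicator in \<open>x\<close> and a continuous function of \<open>\<omega>\<close>. These are the functions that
  the definition of a typical trajectory speaks about.\<close>

lemma step_approximation:
  fixes \<psi> :: "R3 \<times> 'w \<Rightarrow> real"
  assumes cont: "continuous_on UNIV \<psi>"
    and supp: "\<And>x \<omega>. x \<notin> cball 0 R \<Longrightarrow> \<psi> (x, \<omega>) = 0" and e: "\<eta> > 0"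
  obtains C Q where "finite C" "\<And>c. Q c \<in> sets borel" "\<And>c. Q c \<subseteq> cball 0 R"
    "\<And>x \<omega>. \<bar>\<psi> (x, \<omega>) - (\<Sum>c\<in>C. \<psi> (c, \<omega>) * indicator (Q c) x)\<bar> \<le> \<eta> * indicator (cball 0 R) x"
proof -
  have "compact (cball (0::R3) R \<times> (UNIV :: 'w set))"
    using compact_space by (intro compact_Times) auto
  then have "uniformly_continuous_on (cball 0 R \<times> UNIV) \<psi>"
    using cont by (blast intro: compact_uniformly_continuous continuous_on_subset)
  then obtain \<delta> where \<delta>: "\<delta> > 0"
    "\<And>y z. y \<in> cball 0 R \<times> UNIV \<Longrightarrow> z \<in> cball 0 R \<times> UNIV \<Longrightarrow> dist z y < \<delta> \<Longrightarrow> dist (\<psi> z) (\<psi> y) < \<eta>"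
    using e unfolding uniformly_continuous_on_def by meson
  obtain C Q where C: "finite C" "C \<subseteq> cball (0::R3) R" and Q: "\<And>c. Q c \<in> sets borel"
    "\<And>c. Q c \<subseteq> cball 0 R \<inter> ball c \<delta>" "disjoint_family_on Q C" "cball 0 R = (\<Union>c\<in>C. Q c)"
    using compact_finite_borel_partition[OF compact_cball \<delta>(1)] by metis
  show thesis
  proof
    show "finite C" "\<And>c. Q c \<in> sets borel" by fact+
    show QR: "Q c \<subseteq> cball 0 R" for c using Q(2) by blast
    show "\<bar>\<psi> (x, \<omega>) - (\<Sum>c\<in>C. \<psi> (c, \<omega>) * indicator (Q c) x)\<bar> \<le> \<eta> * indicator (cball 0 R) x" for x \<omega>
    proof (cases "x \<in> cball 0 R")
      case True
      then obtain c where c: "c \<in> C" "x \<in> Q c" using Q(4) by blast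
      have "(\<Sum>c\<in>C. \<psi> (c, \<omega>) * indicator (Q c) x) = \<psi> (c, \<omega>)"
        by (rule sum_indicator_partition[OF C(1) Q(3) c])
      moreover have "dist (x, \<omega>) (c, \<omega>) < \<delta>"
        using c(2) Q(2)[of c] by (auto simp: dist_Pair_Pair dist_commute)
      then have "dist (\<psi> (x, \<omega>)) (\<psi> (c, \<omega>)) < \<eta>"
        using True c(1) C(2) by (intro \<delta>(2)) auto
      ultimately show ?thesis using True by (simp add: dist_real_def)
    next
      case False
      then have "x \<notin> Q c" for c using QR by blast
      then show ?thesis using False supp by simp
    qed
  qed
qed

lemma section_continuous: "continuous_on UNIV \<psi> \<Longrightarrow> continuous_on UNIV (\<lambda>\<omega>. \<psi> (c :: R3, \<omega> :: 'w) :: real)"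
  by (rule continuous_on_compose2[of UNIV \<psi>]) (auto intro!: continuous_intros)

lemma step_function_integral:
  fixes \<psi> :: "R3 \<times> 'w \<Rightarrow> real" and Q :: "R3 \<Rightarrow> R3 set"
  assumes "finite C" "\<And>c. Q c \<in> sets borel" "\<And>c. Q c \<subseteq> cball 0 R" "continuous_on UNIV \<psi>"
  shows "integrable (lborel \<Otimes>\<^sub>M P) (\<lambda>z. \<Sum>c\<in>C. \<psi> (c, snd z) * indicator (Q c) (fst z))"
    and "(\<integral>z. (\<Sum>c\<in>C. \<psi> (c, snd z) * indicator (Q c) (fst z)) \<partial>(lborel \<Otimes>\<^sub>M P)) =
      (\<Sum>c\<in>C. measure lborel (Q c) * (\<integral>\<omega>. \<psi> (c, \<omega>) \<partial>P))"
proof -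
  interpret pair_sigma_finite lborel P by (rule pair_sigma_finite_lborel)
  have fin: "emeasure lborel (Q c) < \<infinity>" for c
    by (rule emeasure_bounded_finite[OF bounded_subset[OF bounded_cball assms(3)]])
  have i: "integrable lborel (indicator (Q c) :: R3 \<Rightarrow> real)" for c
    using assms(2) fin by (intro integrable_real_indicator) auto
  have j: "integrable P (\<lambda>\<omega>. \<psi> (c, \<omega>))" for c
    by (rule continuous_integrable[OF section_continuous[OF assms(4)]])
  have k: "integrable (lborel \<Otimes>\<^sub>M P) (\<lambda>(x, \<omega>). indicator (Q c) x * \<psi> (c, \<omega>))" for c
  proof (rule Fubini_integrable)
    have [measurable]: "(\<lambda>\<omega>. \<psi> (c, \<omega>)) \<in> borel_measurable P" using j[of c] by simp
    have [measurable]: "Q c \<in> sets lborel" using assms(2) by simp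
    show "(\<lambda>(x, \<omega>). indicator (Q c) x * \<psi> (c, \<omega>)) \<in> borel_measurable (lborel \<Otimes>\<^sub>M P)"
      by measurable
    have "(\<lambda>x. \<integral>\<omega>. norm (case (x, \<omega>) of (x, \<omega>) \<Rightarrow> indicator (Q c) x * \<psi> (c, \<omega>)) \<partial>P) =
        (\<lambda>x. indicator (Q c) x * (\<integral>\<omega>. \<bar>\<psi> (c, \<omega>)\<bar> \<partial>P))"
      by (simp add: abs_mult)
    then show "integrable lborel (\<lambda>x. \<integral>\<omega>. norm (case (x, \<omega>) of (x, \<omega>) \<Rightarrow> indicator (Q c) x * \<psi> (c, \<omega>)) \<partial>P)"
      using i[of c] by simp
    show "AE x in lborel. integrable P (\<lambda>\<omega>. case (x, \<omega>) of (x, \<omega>) \<Rightarrow> indicator (Q c) x * \<psi> (c, \<omega>))"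
      using j[of c] by simp
  qed
  show "integrable (lborel \<Otimes>\<^sub>M P) (\<lambda>z. \<Sum>c\<in>C. \<psi> (c, snd z) * indicator (Q c) (fst z))"
    using k by (intro Bochner_Integration.integrable_sum) (simp add: split_beta' mult.commute)
  have "(\<integral>z. \<psi> (c, snd z) * indicator (Q c) (fst z) \<partial>(lborel \<Otimes>\<^sub>M P)) =
      measure lborel (Q c) * (\<integral>\<omega>. \<psi> (c, \<omega>) \<partial>P)" for c
    using integral_fst'[OF k[of c]] assms(2)
    by (simp add: split_beta' mult.commute)
  then show "(\<integral>z. (\<Sum>c\<in>C. \<psi> (c, snd z) * indicator (Q c) (fst z)) \<partial>(lborel \<Otimes>\<^sub>M P)) =
      (\<Sum>c\<in>C. measure lborel (Q c) * (\<integral>\<omega>. \<psi> (c, \<omega>) \<partial>P))"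
    using k by (subst Bochner_Integration.integral_sum) (auto simp: split_beta' mult.commute)
qed

text \<open>For general metric spaces the product of the Borel \<open>\<sigma>\<close>-algebras can be smaller than the Borel
  \<open>\<sigma>\<close>-algebra of the product, so continuity alone does not give measurability. Compactness does, through
  uniform approximation by step functions.\<close>

lemma test_function_measurable:
  fixes \<psi> :: "R3 \<times> 'w \<Rightarrow> real"
  assumes "\<psi> \<in> test_functions"
  shows "\<psi> \<in> borel_measurable (lborel \<Otimes>\<^sub>M P)"
proof -
  obtain N :: nat where supp: "\<And>x \<omega>. x \<notin> cball 0 (real N) \<Longrightarrow> \<psi> (x, \<omega>) = 0"
    using assms unfolding test_functions_def by blast
  note cont = test_functions_continuous[OF assms]
  have "\<exists>\<sigma>. \<sigma> \<in> borel_measurable (lborel \<Otimes>\<^sub>M P) \<and> (\<forall>z. \<bar>\<psi> z - \<sigma> z\<bar> \<le> 1 / real (Suc k))" for k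
  proof -
    have pos: "1 / real (Suc k) > 0" by simp
    obtain C Q where C: "finite C" "\<And>c. Q c \<in> sets borel" "\<And>c. Q c \<subseteq> cball 0 (real N)"
      "\<And>x \<omega>. \<bar>\<psi> (x, \<omega>) - (\<Sum>c\<in>C. \<psi> (c, \<omega>) * indicator (Q c) x)\<bar>
         \<le> 1 / real (Suc k) * indicator (cball 0 (real N)) x"
      using step_approximation[OF cont supp pos] by blast
    have "\<bar>\<psi> z - (\<Sum>c\<in>C. \<psi> (c, snd z) * indicator (Q c) (fst z))\<bar> \<le> 1 / real (Suc k)" for z
      using C(4)[of "fst z" "snd z"] by (auto simp: indicator_def split: if_splits intro: order_trans)
    moreover have "(\<lambda>z. \<Sum>c\<in>C. \<psi> (c, snd z) * indicator (Q c) (fst z)) \<in> borel_measurable (lborel \<Otimes>\<^sub>M P)"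
      by (rule borel_measurable_integrable[OF step_function_integral(1)[OF C(1-3) cont]])
    ultimately show ?thesis by blast
  qed
  then obtain \<sigma> where \<sigma>: "\<And>k. \<sigma> k \<in> borel_measurable (lborel \<Otimes>\<^sub>M P)"
    "\<And>k z. \<bar>\<psi> z - \<sigma> k z\<bar> \<le> 1 / real (Suc k)" by metis
  show ?thesis
  proof (rule borel_measurable_LIMSEQ_real[OF _ \<sigma>(1)])
    fix z :: "R3 \<times> 'w"
    have "(\<lambda>k. \<sigma> k z - \<psi> z) \<longlonglongrightarrow> 0"
      using \<sigma>(2)[of z] by (intro Lim_null_comparison[OF _ LIMSEQ_Suc[OF lim_1_over_n]]) (auto simp: abs_minus_commute)
    then show "(\<lambda>k. \<sigma> k z) \<longlonglongrightarrow> \<psi> z" by (rule LIM_zero_cancel)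
  qed
qed

lemma test_function_integrable:
  fixes \<psi> :: "R3 \<times> 'w \<Rightarrow> real"
  assumes "\<psi> \<in> test_functions"
  shows "integrable (lborel \<Otimes>\<^sub>M P) \<psi>"
proof -
  obtain N :: nat where supp: "\<And>x \<omega>. x \<notin> cball 0 (real N) \<Longrightarrow> \<psi> (x, \<omega>) = 0"
    using assms unfolding test_functions_def by blast
  note cont = test_functions_continuous[OF assms]
  have cb: "cball (0::R3) (real N) \<in> sets lborel" by simp
  have UNIV_P: "UNIV \<in> sets P" using sets.top[of P] space_P by simp
  obtain C Q where C: "finite C" "\<And>c. Q c \<in> sets borel" "\<And>c. Q c \<subseteq> cball 0 (real N)"
      "\<And>x \<omega>. \<bar>\<psi> (x, \<omega>) - (\<Sum>c\<in>C. \<psi> (c, \<omega>) * indicator (Q c) x)\<bar>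
         \<le> 1 * indicator (cball 0 (real N)) x"
    using step_approximation[OF cont supp zero_less_one] by blast
  have step: "integrable (lborel \<Otimes>\<^sub>M P) (\<lambda>z. \<Sum>c\<in>C. \<psi> (c, snd z) * indicator (Q c) (fst z))"
    by (rule step_function_integral(1)[OF C(1-3) cont])
  have box: "integrable (lborel \<Otimes>\<^sub>M P) (indicator (cball 0 (real N) \<times> UNIV) :: R3 \<times> 'w \<Rightarrow> real)"
    using emeasure_cylinder[OF cb] UNIV_P emeasure_bounded_finite[OF bounded_cball, of "0::R3" "real N"]
    by (intro integrable_real_indicator) (auto intro!: pair_measureI)
  have "integrable (lborel \<Otimes>\<^sub>M P) (\<lambda>z. \<psi> z - (\<Sum>c\<in>C. \<psi> (c, snd z) * indicator (Q c) (fst z)))"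
  proof (rule Bochner_Integration.integrable_bound[OF box])
    show "(\<lambda>z. \<psi> z - (\<Sum>c\<in>C. \<psi> (c, snd z) * indicator (Q c) (fst z))) \<in> borel_measurable (lborel \<Otimes>\<^sub>M P)"
      by (rule borel_measurable_diff[OF test_function_measurable[OF assms] borel_measurable_integrable[OF step]])
    show "AE z in lborel \<Otimes>\<^sub>M P. norm (\<psi> z - (\<Sum>c\<in>C. \<psi> (c, snd z) * indicator (Q c) (fst z)))
        \<le> norm (indicator (cball 0 (real N) \<times> UNIV) z :: real)"
      using C(4) by (intro AE_I2) (auto simp: indicator_times)
  qed
  from Bochner_Integration.integrable_add[OF this step] show ?thesis by simp
qed

lemma test_function_L2: "\<psi> \<in> test_functions \<Longrightarrow> \<psi> \<in> L2 (lborel \<Otimes>\<^sub>M P)"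
  by (simp add: L2_def test_function_measurable test_function_integrable[OF test_functions_square])

end

section \<open>Ergodic limits along a typical trajectory\<close>

lemma set_integral_scaled_argument:
  fixes f :: "'a::euclidean_space \<Rightarrow> real"
  assumes t: "t > 0" and A: "A \<in> sets borel" and f: "f \<in> borel_measurable borel"
  shows "(LINT x:((*\<^sub>R) t ` A)|lebesgue. f x) = t ^ DIM('a) * (\<integral>x. indicator A x * f (t *\<^sub>R x) \<partial>lborel)"
proof -
  have img: "(*\<^sub>R) t ` A = (\<lambda>x. (1 / t) *\<^sub>R x) -` A"
    using t by (force simp: image_iff)
  have "(\<lambda>x. (1 / t) *\<^sub>R x) \<in> borel_measurable (borel :: 'a measure)" by measurable
  then have tA: "(*\<^sub>R) t ` A \<in> sets borel"
    using measurable_sets[OF _ A, of "\<lambda>x. (1 / t) *\<^sub>R x" borel] by (simp add: img)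
  have m: "(\<lambda>x. indicator ((*\<^sub>R) t ` A) x *\<^sub>R f x) \<in> borel_measurable borel"
    using tA f by measurable
  have "(LINT x:((*\<^sub>R) t ` A)|lebesgue. f x) = (\<integral>x. indicator ((*\<^sub>R) t ` A) x *\<^sub>R f x \<partial>lborel)"
    unfolding set_lebesgue_integral_def using m by (intro integral_completion) simp
  also have "\<dots> = (\<integral>x. indicator ((*\<^sub>R) t ` A) x *\<^sub>R f x
      \<partial>density (distr lborel borel (\<lambda>x. 0 + t *\<^sub>R x)) (\<lambda>_. \<bar>t\<bar> ^ DIM('a)))"
    using lborel_affine[of t "0::'a"] t by simp
  also have "\<dots> = (\<integral>x. t ^ DIM('a) * (indicator ((*\<^sub>R) t ` A) (t *\<^sub>R x) *\<^sub>R f (t *\<^sub>R x)) \<partial>lborel)"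
    using t m by (simp add: integral_density integral_distr)
  also have "\<dots> = (\<integral>x. t ^ DIM('a) * (indicator A x * f (t *\<^sub>R x)) \<partial>lborel)"
    using t by (intro Bochner_Integration.integral_cong refl) (auto simp: indicator_def)
  finally show ?thesis by simp
qed

lemma integral_diff_bound:
  fixes f g :: "'a \<Rightarrow> real"
  assumes "integrable M f" "integrable M g" "A \<in> sets M" "emeasure M A < \<infinity>"
    and "\<And>x. x \<in> space M \<Longrightarrow> \<bar>f x - g x\<bar> \<le> \<eta> * indicator A x"
  shows "\<bar>(\<integral>x. f x \<partial>M) - (\<integral>x. g x \<partial>M)\<bar> \<le> \<eta> * measure M A"
proof -
  have "\<bar>(\<integral>x. f x \<partial>M) - (\<integral>x. g x \<partial>M)\<bar> = \<bar>\<integral>x. f x - g x \<partial>M\<bar>"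
    using assms(1,2) by simp
  also have "\<dots> \<le> (\<integral>x. \<bar>f x - g x\<bar> \<partial>M)" by (rule integral_abs_bound)
  also have "\<dots> \<le> (\<integral>x. \<eta> * indicator A x \<partial>M)"
    using assms by (intro integral_mono) auto
  also have "\<dots> = \<eta> * measure M A" using assms(3,4) by simp
  finally show ?thesis .
qed

context stochastic_setting
begin

text \<open>The substitution \<open>y = x / \<epsilon> n\<close> turns the integral over \<open>A\<close> into the ergodic average over the
  dilated set \<open>A / \<epsilon> n\<close>. The definition of a typical trajectory covers sets of positive measure; on
  null sets both sides vanish.\<close>

lemma typical_average:
  assumes \<omega>: "\<omega> \<in> typical P T (\<lambda>_. 1)" and A: "A \<in> sets borel" "bounded A"
    and b: "continuous_on UNIV b" and \<epsilon>: "\<And>n. \<epsilon> n > 0" "\<epsilon> \<longlonglongrightarrow> 0"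
  shows "(\<lambda>n. \<integral>x. indicator A x * b (T (x /\<^sub>R \<epsilon> n) \<omega>) \<partial>lborel)
    \<longlonglongrightarrow> measure lborel A * (\<integral>\<omega>'. b \<omega>' \<partial>P)"
proof -
  have leb: "measure lebesgue A = measure lborel A" using A(1) by (simp add: measure_completion)
  show ?thesis
  proof (cases "measure lborel A = 0")
    case True
    then have "emeasure lborel A = 0"
      using emeasure_bounded_finite[OF A(2)] emeasure_eq_ennreal_measure[of lborel A] by (auto simp: less_top)
    then have "AE x in lborel. x \<notin> A"
      using A(1) by (intro AE_not_in) (auto simp: null_sets_def)
    then have "AE x in lborel. indicator A x * b (T (x /\<^sub>R \<epsilon> n) \<omega>) = 0" for n
      by eventually_elim auto
    then have "(\<integral>x. indicator A x * b (T (x /\<^sub>R \<epsilon> n) \<omega>) \<partial>lborel) = 0" for n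
      by (rule integral_eq_zero_AE)
    then show ?thesis using True by simp
  next
    case False
    define f where "f x = b (T x \<omega>)" for x
    have pos: "measure lebesgue A > 0" using False leb by (simp add: zero_less_measure_iff)
    have "((\<lambda>t. 1 / (t ^ 3 * measure lebesgue A) * (LINT x:((*\<^sub>R) t ` A)|lebesgue. f x))
        \<longlongrightarrow> (\<integral>\<omega>'. b \<omega>' \<partial>P)) at_top"
      using \<omega> A b pos unfolding typical_def f_def by auto
    moreover have "filterlim (\<lambda>n. inverse (\<epsilon> n)) at_top sequentially"
      using \<epsilon> by (intro filterlim_inverse_at_top) auto
    ultimately have lim: "(\<lambda>n. 1 / (inverse (\<epsilon> n) ^ 3 * measure lebesgue A) *
        (LINT x:((*\<^sub>R) (inverse (\<epsilon> n)) ` A)|lebesgue. f x)) \<longlonglongrightarrow> (\<integral>\<omega>'. b \<omega>' \<partial>P)"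
      by (rule filterlim_compose)
    have "continuous_on UNIV f" unfolding f_def
      by (rule continuous_on_compose2[OF b]) (use trajectory_continuous[of 1] in auto)
    then have "f \<in> borel_measurable borel" by (rule borel_measurable_continuous_onI)
    then have "(LINT x:((*\<^sub>R) (inverse (\<epsilon> n)) ` A)|lebesgue. f x) =
        inverse (\<epsilon> n) ^ 3 * (\<integral>x. indicator A x * f (x /\<^sub>R \<epsilon> n) \<partial>lborel)" for n
      using set_integral_scaled_argument[of "inverse (\<epsilon> n)" A f] A(1) \<epsilon>(1)[of n] by simp
    then have "(\<lambda>n. (\<integral>x. indicator A x * f (x /\<^sub>R \<epsilon> n) \<partial>lborel) / measure lebesgue A) \<longlonglongrightarrow> (\<integral>\<omega>'. b \<omega>' \<partial>P)"
      using lim \<epsilon>(1) by (simp add: less_imp_neq[THEN not_sym])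
    from tendsto_mult[OF tendsto_const[of "measure lebesgue A"] this]
    show ?thesis using pos leb by (simp add: f_def)
  qed
qed

lemma sampling_map_continuous: "continuous_on UNIV (\<lambda>x. (x, T (x /\<^sub>R e) \<omega>))"
  using trajectory_continuous[of "inverse e" \<omega>] by (intro continuous_intros)

lemma sampled_continuous:
  assumes "continuous_on UNIV (\<psi> :: R3 \<times> 'w \<Rightarrow> real)"
  shows "continuous_on UNIV (\<lambda>x. \<psi> (x, T (x /\<^sub>R e) \<omega>))"
  by (rule continuous_on_compose2[OF assms sampling_map_continuous]) auto

lemma sampled_integrable:
  assumes "\<psi> \<in> test_functions"
  shows "integrable lborel (\<lambda>x. \<psi> (x, T (x /\<^sub>R e) \<omega>))"
proof -
  obtain N :: nat where supp: "\<And>x \<omega>. x \<notin> cball 0 (real N) \<Longrightarrow> \<psi> (x, \<omega>) = 0"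
    using assms unfolding test_functions_def by blast
  have "integrable lborel (\<lambda>x. indicator (cball 0 (real N)) x *\<^sub>R \<psi> (x, T (x /\<^sub>R e) \<omega>))"
    by (rule borel_integrable_compact)
      (auto intro: continuous_on_subset[OF sampled_continuous[OF test_functions_continuous[OF assms]]])
  also have "(\<lambda>x. indicator (cball 0 (real N)) x *\<^sub>R \<psi> (x, T (x /\<^sub>R e) \<omega>)) = (\<lambda>x. \<psi> (x, T (x /\<^sub>R e) \<omega>))"
    using supp by (auto simp: indicator_def fun_eq_iff)
  finally show ?thesis .
qed

lemma sampled_L2:
  assumes "\<psi> \<in> test_functions"
  shows "(\<lambda>x. \<psi> (x, T (x /\<^sub>R e) \<omega>)) \<in> L2 lebesgue"
  using sampled_integrable[OF test_functions_square[OF assms], of e \<omega>]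
    sampled_integrable[OF assms, of e \<omega>]
  by (auto simp: L2_def integrable_completion intro: measurable_completion)

text \<open>The error of the step approximation is uniform, hence contributes at most \<open>\<eta>\<close> times the volume of the
  support, both before the limit (uniformly in \<open>n\<close>) and in the limit.\<close>

lemma sampled_integral_limit:
  assumes \<omega>: "\<omega> \<in> typical P T (\<lambda>_. 1)" and \<epsilon>: "\<And>n. \<epsilon> n > 0" "\<epsilon> \<longlonglongrightarrow> 0"
    and \<psi>: "\<psi> \<in> test_functions"
  shows "(\<lambda>n. \<integral>x. \<psi> (x, T (x /\<^sub>R \<epsilon> n) \<omega>) \<partial>lborel) \<longlonglongrightarrow> (\<integral>z. \<psi> z \<partial>(lborel \<Otimes>\<^sub>M P))"
proof (rule LIMSEQ_I)
  fix e :: real assume "e > 0"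
  obtain N :: nat where supp: "\<And>x \<omega>. x \<notin> cball 0 (real N) \<Longrightarrow> \<psi> (x, \<omega>) = 0"
    using \<psi> unfolding test_functions_def by blast
  note cont = test_functions_continuous[OF \<psi>]
  define A where "A = cball (0::R3) (real N)"
  have A: "A \<in> sets lborel" "emeasure lborel A < \<infinity>"
    unfolding A_def using emeasure_bounded_finite[OF bounded_cball, of "0::R3" "real N"] by auto
  define \<eta> where "\<eta> = e / (3 * (measure lborel A + 1))"
  have \<eta>: "\<eta> > 0" "\<eta> * measure lborel A < e / 3"
    using \<open>e > 0\<close> measure_nonneg[of lborel A] unfolding \<eta>_def by (auto simp: field_simps add_pos_nonneg)
  obtain C Q where C: "finite C" "\<And>c. Q c \<in> sets borel" "\<And>c. Q c \<subseteq> cball 0 (real N)"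
    and close: "\<And>x \<omega>. \<bar>\<psi> (x, \<omega>) - (\<Sum>c\<in>C. \<psi> (c, \<omega>) * indicator (Q c) x)\<bar>
         \<le> \<eta> * indicator (cball 0 (real N)) x"
    using step_approximation[OF cont supp \<eta>(1)] by blast
  define s where "s n = (\<integral>x. (\<Sum>c\<in>C. \<psi> (c, T (x /\<^sub>R \<epsilon> n) \<omega>) * indicator (Q c) x) \<partial>lborel)" for n
  have int: "integrable lborel (\<lambda>x. \<psi> (c, T (x /\<^sub>R \<epsilon> n) \<omega>) * indicator (Q c) x)" for c n
  proof -
    have "continuous_on UNIV (\<lambda>x. \<psi> (c, T (x /\<^sub>R \<epsilon> n) \<omega>))"
      by (rule continuous_on_compose2[OF section_continuous[OF cont] trajectory_continuous]) auto
    then have "set_integrable lborel (cball 0 (real N)) (\<lambda>x. \<psi> (c, T (x /\<^sub>R \<epsilon> n) \<omega>))"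
      unfolding set_integrable_def by (intro borel_integrable_compact) (auto intro: continuous_on_subset)
    then have "set_integrable lborel (Q c) (\<lambda>x. \<psi> (c, T (x /\<^sub>R \<epsilon> n) \<omega>))"
      by (rule set_integrable_subset) (use C in auto)
    then show ?thesis by (simp add: set_integrable_def mult.commute)
  qed
  have "(\<lambda>n. \<Sum>c\<in>C. \<integral>x. indicator (Q c) x * \<psi> (c, T (x /\<^sub>R \<epsilon> n) \<omega>) \<partial>lborel)
      \<longlonglongrightarrow> (\<Sum>c\<in>C. measure lborel (Q c) * (\<integral>\<omega>'. \<psi> (c, \<omega>') \<partial>P))"
    by (intro tendsto_sum typical_average[OF \<omega> C(2) bounded_subset[OF bounded_cball C(3)] section_continuous[OF cont] \<epsilon>])
  also have "(\<lambda>n. \<Sum>c\<in>C. \<integral>x. indicator (Q c) x * \<psi> (c, T (x /\<^sub>R \<epsilon> n) \<omega>) \<partial>lborel) = s"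
    unfolding s_def using int by (simp add: mult.commute)
  finally have "s \<longlonglongrightarrow> (\<Sum>c\<in>C. measure lborel (Q c) * (\<integral>\<omega>'. \<psi> (c, \<omega>') \<partial>P))" .
  then obtain n0 where n0: "\<And>n. n \<ge> n0 \<Longrightarrow>
      \<bar>s n - (\<Sum>c\<in>C. measure lborel (Q c) * (\<integral>\<omega>'. \<psi> (c, \<omega>') \<partial>P))\<bar> < e / 3"
    using LIMSEQ_D[of s _ "e / 3"] \<open>e > 0\<close> by auto
  have sampled: "\<bar>(\<integral>x. \<psi> (x, T (x /\<^sub>R \<epsilon> n) \<omega>) \<partial>lborel) - s n\<bar> \<le> \<eta> * measure lborel A" for n
    unfolding s_def
    by (rule integral_diff_bound[OF sampled_integrable[OF \<psi>] _ A])
      (use int close in \<open>auto simp: A_def\<close>)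
  have UNIV_P: "UNIV \<in> sets P" using sets.top[of P] space_P by simp
  have "\<bar>(\<integral>z. \<psi> z \<partial>(lborel \<Otimes>\<^sub>M P)) - (\<Sum>c\<in>C. measure lborel (Q c) * (\<integral>\<omega>'. \<psi> (c, \<omega>') \<partial>P))\<bar>
      \<le> \<eta> * measure (lborel \<Otimes>\<^sub>M P) (A \<times> UNIV)"
    unfolding step_function_integral(2)[OF C cont, symmetric]
  proof (rule integral_diff_bound[OF test_function_integrable[OF \<psi>] step_function_integral(1)[OF C cont]])
    show "A \<times> UNIV \<in> sets (lborel \<Otimes>\<^sub>M P)" using A(1) UNIV_P by (rule pair_measureI)
    show "emeasure (lborel \<Otimes>\<^sub>M P) (A \<times> UNIV) < \<infinity>" using A by (simp only: emeasure_cylinder)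
    show "\<bar>\<psi> z - (\<Sum>c\<in>C. \<psi> (c, snd z) * indicator (Q c) (fst z))\<bar> \<le> \<eta> * indicator (A \<times> UNIV) z" for z
      using close[of "fst z" "snd z"] by (simp add: A_def indicator_times)
  qed
  also have "measure (lborel \<Otimes>\<^sub>M P) (A \<times> UNIV) = measure lborel A"
    using emeasure_cylinder[OF A(1)] by (simp add: measure_def)
  finally have mean: "\<bar>(\<integral>z. \<psi> z \<partial>(lborel \<Otimes>\<^sub>M P)) - (\<Sum>c\<in>C. measure lborel (Q c) * (\<integral>\<omega>'. \<psi> (c, \<omega>') \<partial>P))\<bar>
      \<le> \<eta> * measure lborel A" .
  have "norm ((\<integral>x. \<psi> (x, T (x /\<^sub>R \<epsilon> n) \<omega>) \<partial>lborel) - (\<integral>z. \<psi> z \<partial>(lborel \<Otimes>\<^sub>M P))) < e" if "n \<ge> n0" for n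
    using n0[OF that] sampled[of n] mean \<eta>(2) unfolding real_norm_def by linarith
  then show "\<exists>n0. \<forall>n\<ge>n0. norm ((\<integral>x. \<psi> (x, T (x /\<^sub>R \<epsilon> n) \<omega>) \<partial>lborel) - (\<integral>z. \<psi> z \<partial>(lborel \<Otimes>\<^sub>M P))) < e"
    by blast
qed

section \<open>Two-scale compactness\<close>

text \<open>The limit \<open>F \<psi>\<close> of the pairings along a suitable subsequence is linear in \<open>\<psi>\<close>. Cauchy--Schwarz before the
  limit, and the ergodic limit of the sampled \<open>\<psi>\<^sup>2\<close>, bound it by the norm of \<open>\<psi>\<close> on
  the product space. Thus \<open>F\<close> is represented by a square integrable function.\<close>

lemma weak_stochastic_two_scale_compactness:
  assumes v: "\<And>n. v n \<in> L2 lebesgue" "\<And>n. (\<integral>x. (v n x)\<^sup>2 \<partial>lebesgue) \<le> c\<^sup>2" "c \<ge> 0"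
    and \<omega>: "\<omega> \<in> typical P T (\<lambda>_. 1)" and \<epsilon>: "\<And>n. \<epsilon> n > 0" "\<epsilon> \<longlonglongrightarrow> 0"
  shows "\<exists>w \<in> L2 (lborel \<Otimes>\<^sub>M P). \<exists>r :: nat \<Rightarrow> nat. strict_mono r \<and>
    (\<forall>\<psi> \<in> test_functions.
      (\<lambda>n. \<integral>x. v (r n) x * \<psi> (x, T (x /\<^sub>R \<epsilon> (r n)) \<omega>) \<partial>lebesgue)
        \<longlonglongrightarrow> (\<integral>z. w z * \<psi> z \<partial>(lborel \<Otimes>\<^sub>M P)))"
proof -
  define h where "h n x = (x, T (x /\<^sub>R \<epsilon> n) \<omega>)" for n x
  have h: "h n \<in> lebesgue \<rightarrow>\<^sub>M borel" for n
    unfolding h_def using borel_measurable_continuous_onI[OF sampling_map_continuous]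
    by (intro measurable_completion) simp
  have vimage: "h n -` (cball 0 (real N) \<times> UNIV) = cball 0 (real N)" for n N
    by (auto simp: h_def)
  have fin: "emeasure lebesgue (h n -` (cball 0 (real N) \<times> UNIV) \<inter> space lebesgue)
      \<le> ennreal (measure lborel (cball (0::R3) (real N)))" for n N
    using emeasure_bounded_finite[OF bounded_cball, of "0::R3" "real N"]
    by (simp add: vimage emeasure_eq_ennreal_measure less_top)
  have K: "compact (cball (0::R3) (real N) \<times> (UNIV :: 'w set))" for N
    using compact_space by (intro compact_Times) auto
  obtain r :: "nat \<Rightarrow> nat" where r: "strict_mono r"
    and conv: "\<forall>N \<psi>. continuous_on UNIV \<psi> \<longrightarrow> (\<forall>z. z \<notin> cball 0 (real N) \<times> UNIV \<longrightarrow> \<psi> z = 0) \<longrightarrow>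
      convergent (\<lambda>n. \<integral>x. v (r n) x * \<psi> (h (r n) x) \<partial>lebesgue)"
    using sampling_pairing_convergent_subsequence[where v=v and h=h and
        K="\<lambda>N. cball 0 (real N) \<times> UNIV", OF v h K fin measure_nonneg] by blast
  define F where "F \<psi> = lim (\<lambda>n. \<integral>x. v (r n) x * \<psi> (h (r n) x) \<partial>lebesgue)" for \<psi>
  have F: "(\<lambda>n. \<integral>x. v (r n) x * \<psi> (h (r n) x) \<partial>lebesgue) \<longlonglongrightarrow> F \<psi>" if \<psi>: "\<psi> \<in> test_functions" for \<psi>
  proof -
    obtain N :: nat where "\<And>x \<omega>. x \<notin> cball 0 (real N) \<Longrightarrow> \<psi> (x, \<omega>) = 0"
      using \<psi> unfolding test_functions_def by blast
    then have "\<forall>z. z \<notin> cball 0 (real N) \<times> UNIV \<longrightarrow> \<psi> z = 0"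
      by (metis SigmaI UNIV_I surj_pair)
    then have "convergent (\<lambda>n. \<integral>x. v (r n) x * \<psi> (h (r n) x) \<partial>lebesgue)"
      using conv test_functions_continuous[OF \<psi>] by blast
    then show ?thesis by (simp add: F_def convergent_LIMSEQ_iff)
  qed
  have hL2: "(\<lambda>x. \<psi> (h n x)) \<in> L2 lebesgue" if "\<psi> \<in> test_functions" for \<psi> n
    unfolding h_def by (rule sampled_L2[OF that])
  have F_lin: "F (\<lambda>z. f z + a * g z) = F f + a * F g" if f: "f \<in> test_functions" and g: "g \<in> test_functions" for f g a
  proof -
    have "(\<integral>x. v n x * (f (h n x) + a * g (h n x)) \<partial>lebesgue) =
        (\<integral>x. v n x * f (h n x) \<partial>lebesgue) + a * (\<integral>x. v n x * g (h n x) \<partial>lebesgue)" for n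
    proof -
      have "(\<integral>x. v n x * (f (h n x) + a * g (h n x)) \<partial>lebesgue) =
          (\<integral>x. v n x * f (h n x) + a * (v n x * g (h n x)) \<partial>lebesgue)"
        by (simp add: algebra_simps)
      then show ?thesis
        using L2_mult_integrable[OF v(1) hL2[OF f], of n n] L2_mult_integrable[OF v(1) hL2[OF g], of n n] by simp
    qed
    then have "(\<lambda>n. \<integral>x. v (r n) x * (f (h (r n) x) + a * g (h (r n) x)) \<partial>lebesgue) \<longlonglongrightarrow> F f + a * F g"
      by (simp only:) (intro tendsto_intros F f g)
    then show ?thesis
      using F[OF test_functions_add_scaled[OF f g, of a]] LIMSEQ_unique by blast
  qed
  have F_bd: "\<bar>F f\<bar> \<le> c * sqrt (\<integral>z. (f z)\<^sup>2 \<partial>(lborel \<Otimes>\<^sub>M P))" if f: "f \<in> test_functions" for f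
  proof (rule LIMSEQ_le)
    show "(\<lambda>n. \<bar>\<integral>x. v (r n) x * f (h (r n) x) \<partial>lebesgue\<bar>) \<longlonglongrightarrow> \<bar>F f\<bar>"
      by (intro tendsto_rabs F f)
    have "(\<lambda>n. \<integral>x. (f (x, T (x /\<^sub>R (\<epsilon> \<circ> r) n) \<omega>))\<^sup>2 \<partial>lborel) \<longlonglongrightarrow> (\<integral>z. (f z)\<^sup>2 \<partial>(lborel \<Otimes>\<^sub>M P))"
      using sampled_integral_limit[OF \<omega> _ LIMSEQ_subseq_LIMSEQ[OF \<epsilon>(2) r] test_functions_square[OF f]] \<epsilon>(1)
      by simp
    moreover have "(\<integral>x. (f (x, T (x /\<^sub>R \<epsilon> n) \<omega>))\<^sup>2 \<partial>lborel) = (\<integral>x. (f (h n x))\<^sup>2 \<partial>lebesgue)" for n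
      using borel_measurable_integrable[OF sampled_integrable[OF test_functions_square[OF f]]]
      unfolding h_def by (intro integral_completion[symmetric]) simp
    ultimately have "(\<lambda>n. \<integral>x. (f (h (r n) x))\<^sup>2 \<partial>lebesgue) \<longlonglongrightarrow> (\<integral>z. (f z)\<^sup>2 \<partial>(lborel \<Otimes>\<^sub>M P))"
      by simp
    then show "(\<lambda>n. c * sqrt (\<integral>x. (f (h (r n) x))\<^sup>2 \<partial>lebesgue)) \<longlonglongrightarrow> c * sqrt (\<integral>z. (f z)\<^sup>2 \<partial>(lborel \<Otimes>\<^sub>M P))"
      by (intro tendsto_intros)
    have "\<bar>\<integral>x. v n x * f (h n x) \<partial>lebesgue\<bar> \<le> c * sqrt (\<integral>x. (f (h n x))\<^sup>2 \<partial>lebesgue)" for n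
    proof -
      have "sqrt (\<integral>x. (v n x)\<^sup>2 \<partial>lebesgue) \<le> c" using v(2)[of n] v(3) by (simp add: real_le_lsqrt)
      then show ?thesis
        by (intro order_trans[OF L2_Cauchy_Schwarz_sqrt[OF v(1) hL2[OF f]]] mult_right_mono) auto
    qed
    then show "\<exists>n0. \<forall>n\<ge>n0. \<bar>\<integral>x. v (r n) x * f (h (r n) x) \<partial>lebesgue\<bar> \<le> c * sqrt (\<integral>x. (f (h (r n) x))\<^sup>2 \<partial>lebesgue)"
      by blast
  qed
  have nonempty: "test_functions \<noteq> ({} :: (R3 \<times> 'w \<Rightarrow> real) set)"
    by (auto simp: test_functions_def intro!: exI[of _ "\<lambda>_. 0"])
  obtain w where w: "w \<in> L2 (lborel \<Otimes>\<^sub>M P)"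
    "\<And>f. f \<in> test_functions \<Longrightarrow> F f = (\<integral>z. w z * f z \<partial>(lborel \<Otimes>\<^sub>M P))"
    using riesz_on_subspace[OF nonempty _ test_functions_add_scaled F_lin F_bd] test_function_L2 by blast
  have "(\<lambda>n. \<integral>x. v (r n) x * \<psi> (x, T (x /\<^sub>R \<epsilon> (r n)) \<omega>) \<partial>lebesgue) \<longlonglongrightarrow> (\<integral>z. w z * \<psi> z \<partial>(lborel \<Otimes>\<^sub>M P))"
    if "\<psi> \<in> test_functions" for \<psi>
    using F[OF that] w(2)[OF that] by (simp add: h_def)
  with w(1) r show ?thesis by blast
qed

lemma expectation_L2:
  assumes w: "w \<in> L2 (lborel \<Otimes>\<^sub>M P :: (R3 \<times> 'w) measure)"
  shows "(\<lambda>x. \<integral>\<omega>. w (x, \<omega>) \<partial>P) \<in> L2 lebesgue"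
proof -
  interpret pair_sigma_finite lborel P by (rule pair_sigma_finite_lborel)
  have [measurable]: "w \<in> borel_measurable (lborel \<Otimes>\<^sub>M P)" using w by (rule L2_measurable)
  have sq: "integrable (lborel \<Otimes>\<^sub>M P) (\<lambda>z. (w z)\<^sup>2)" using w by (rule L2_square_integrable)
  have meas: "(\<lambda>x. \<integral>\<omega>. w (x, \<omega>) \<partial>P) \<in> borel_measurable lborel" by measurable
  have "integrable lborel (\<lambda>x. (\<integral>\<omega>. w (x, \<omega>) \<partial>P)\<^sup>2)"
  proof (rule Bochner_Integration.integrable_bound[OF integrable_fst'[OF sq]])
    show "(\<lambda>x. (\<integral>\<omega>. w (x, \<omega>) \<partial>P)\<^sup>2) \<in> borel_measurable lborel" using meas by measurable
    show "AE x in lborel. norm ((\<integral>\<omega>. w (x, \<omega>) \<partial>P)\<^sup>2) \<le> norm (\<integral>\<omega>. (w (x, \<omega>))\<^sup>2 \<partial>P)"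
      using AE_integrable_fst'[OF sq]
    proof eventually_elim
      case (elim x)
      have "(\<lambda>\<omega>. w (x, \<omega>)) \<in> L2 P" using elim by (simp add: L2_def)
      moreover have "(\<lambda>_. 1) \<in> L2 P" by (simp add: L2_def)
      ultimately have "(\<integral>\<omega>. w (x, \<omega>) * 1 \<partial>P)\<^sup>2 \<le> (\<integral>\<omega>. (w (x, \<omega>))\<^sup>2 \<partial>P) * (\<integral>\<omega>. 1\<^sup>2 \<partial>P)"
        by (rule L2_Cauchy_Schwarz)
      then show ?case by (simp add: prob_space)
    qed
  qed
  then show ?thesis using meas by (simp add: L2_def integrable_completion measurable_completion)
qed

end

section \<open>The weighted space and the limit\<close>

lemma weight_eq: "weight x = 1 / sqrt (1 + (norm x)\<^sup>2)"
proof -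
  have "weight x = (1 + (norm x)\<^sup>2) powr - (1/2)" by (simp add: weight_def)
  also have "\<dots> = 1 / (1 + (norm x)\<^sup>2) powr (1/2)" by (rule powr_minus_divide)
  also have "\<dots> = 1 / sqrt (1 + (norm x)\<^sup>2)" by (subst powr_half_sqrt) (auto intro: add_nonneg_nonneg)
  finally show ?thesis .
qed

lemma weight_pos: "weight x > 0"
  by (simp add: weight_eq add_pos_nonneg)

lemma weight_continuous: "continuous_on UNIV weight"
proof -
  have "sqrt (1 + (norm x)\<^sup>2) \<noteq> 0" for x :: R3
    using add_pos_nonneg[of 1 "(norm x)\<^sup>2"] by simp
  then show ?thesis unfolding weight_eq[abs_def] by (intro continuous_intros) auto
qed

lemma inverse_weight_square: "1 / (weight x)\<^sup>2 = 1 + (norm x)\<^sup>2"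
  by (simp add: weight_eq power_divide add_nonneg_nonneg)

theorem proposition5p1:
  fixes P :: "'w::metric_space measure"
    and T :: "R3 \<Rightarrow> 'w \<Rightarrow> 'w"
    and a \<kappa> Msat :: "'w \<Rightarrow> real"
    and c_ex C_ex C_DMI C_sat :: real
    and u_eps :: "real \<Rightarrow> R3 \<Rightarrow> real"
    and \<omega>\<^sub>0 :: 'w
    and \<epsilon> :: "nat \<Rightarrow> real"
  assumes "coefficients P T a \<kappa> Msat c_ex C_ex C_DMI C_sat"
    and "\<And>e. e > 0 \<Longrightarrow> u_eps e \<in> L2_weighted"
    and "\<exists>C. \<forall>e>0. L2_weighted_nrm (u_eps e) \<le> C"
    and "\<omega>\<^sub>0 \<in> typical_all P T a \<kappa> Msat"
    and "\<And>n. \<epsilon> n > 0" and "\<epsilon> \<longlonglongrightarrow> 0"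
  shows "\<exists>u \<in> L2_loc P. (\<lambda>x. \<integral>\<omega>. u (x, \<omega>) \<partial>P) \<in> L2_weighted \<and>
    (\<exists>r :: nat \<Rightarrow> nat. strict_mono r \<and>
      (\<forall>\<phi> \<in> Cc_smooth. \<forall>b. continuous_on UNIV b \<longrightarrow>
        (\<lambda>n. \<integral>x. u_eps (\<epsilon> (r n)) x * \<phi> x * b (T (x /\<^sub>R \<epsilon> (r n)) \<omega>\<^sub>0) \<partial>lebesgue)
          \<longlonglongrightarrow> (\<integral>(x, \<omega>). u (x, \<omega>) * \<phi> x * b \<omega> \<partial>(lborel \<Otimes>\<^sub>M P))))"
proof -
  interpret coefficients P T a \<kappa> Msat c_ex C_ex C_DMI C_sat by fact
  obtain c where c: "\<And>e. e > 0 \<Longrightarrow> L2_weighted_nrm (u_eps e) \<le> c" using assms(3) by blast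
  define v where "v n x = u_eps (\<epsilon> n) x * weight x" for n x
  have vL2: "v n \<in> L2 lebesgue" for n
    using assms(2)[OF assms(5)[of n]] unfolding L2_weighted_def v_def by simp
  have sqrt_le: "sqrt (\<integral>x. (v n x)\<^sup>2 \<partial>lebesgue) \<le> c" for n
    using c[OF assms(5)[of n]] unfolding L2_weighted_nrm_def L2_nrm_def v_def .
  have c0: "c \<ge> 0" by (rule order_trans[OF _ sqrt_le]) simp
  have v_le: "(\<integral>x. (v n x)\<^sup>2 \<partial>lebesgue) \<le> c\<^sup>2" for n
    using sqrt_le[of n] by (rule sqrt_le_D)
  have \<omega>0: "\<omega>\<^sub>0 \<in> typical P T (\<lambda>_. 1)" using assms(4) unfolding typical_all_def by blast
  obtain w and r :: "nat \<Rightarrow> nat" where w: "w \<in> L2 (lborel \<Otimes>\<^sub>M P)" and r: "strict_mono r"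
    and lim: "\<forall>\<psi> \<in> test_functions.
      (\<lambda>n. \<integral>x. v (r n) x * \<psi> (x, T (x /\<^sub>R \<epsilon> (r n)) \<omega>\<^sub>0) \<partial>lebesgue)
        \<longlonglongrightarrow> (\<integral>z. w z * \<psi> z \<partial>(lborel \<Otimes>\<^sub>M P))"
    using weak_stochastic_two_scale_compactness[where v=v, OF vL2 v_le c0 \<omega>0 assms(5,6)] by blast
  have w_meas[measurable]: "w \<in> borel_measurable (lborel \<Otimes>\<^sub>M P)" using w by (rule L2_measurable)
  have [measurable]: "weight \<in> borel_measurable borel"
    by (rule borel_measurable_continuous_onI[OF weight_continuous])
  have weight0: "weight x \<noteq> 0" for x using weight_pos[of x] by simp
  \<comment> \<open>The compactness lemma was applied to the functions multiplied by the weight, so the weight is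
    divided out here, and is compensated in the test function below.\<close>
  define u where "u z = w z / weight (fst z)" for z
  have u_meas[measurable]: "u \<in> borel_measurable (lborel \<Otimes>\<^sub>M P)" unfolding u_def by measurable
  have "set_integrable (lborel \<Otimes>\<^sub>M P) (K \<times> space P) (\<lambda>z. (u z)\<^sup>2)" if K: "compact K" for K
  proof -
    obtain B where B: "\<And>x. x \<in> K \<Longrightarrow> norm x \<le> B" using compact_imp_bounded[OF K] by (auto simp: bounded_iff)
    have "K \<in> sets lborel" using K by (simp add: borel_closed compact_imp_closed)
    then have [measurable]: "K \<times> space P \<in> sets (lborel \<Otimes>\<^sub>M P)" by (intro pair_measureI) auto
    have int: "integrable (lborel \<Otimes>\<^sub>M P) (\<lambda>z. (1 + B\<^sup>2) * (w z)\<^sup>2)"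
      using L2_square_integrable[OF w] by simp
    have "(u z)\<^sup>2 \<le> (1 + B\<^sup>2) * (w z)\<^sup>2" if "fst z \<in> K" for z
    proof -
      have "(u z)\<^sup>2 = (1 / (weight (fst z))\<^sup>2) * (w z)\<^sup>2" by (simp add: u_def power_divide)
      also have "\<dots> \<le> (1 + B\<^sup>2) * (w z)\<^sup>2"
        unfolding inverse_weight_square using B[OF that] by (intro mult_right_mono add_left_mono power_mono) auto
      finally show ?thesis .
    qed
    then show ?thesis unfolding set_integrable_def
      by (intro Bochner_Integration.integrable_bound[OF int]) (auto simp: indicator_def intro!: AE_I2)
  qed
  then have u_loc: "u \<in> L2_loc P" using u_meas by (simp add: L2_loc_def)
  have "(\<integral>\<omega>. u (x, \<omega>) \<partial>P) * weight x = (\<integral>\<omega>. w (x, \<omega>) \<partial>P)" for x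
    using weight0[of x] by (simp add: u_def)
  then have u_exp: "(\<lambda>x. \<integral>\<omega>. u (x, \<omega>) \<partial>P) \<in> L2_weighted"
    using expectation_L2[OF w] by (simp add: L2_weighted_def)
  have "(\<lambda>n. \<integral>x. u_eps (\<epsilon> (r n)) x * \<phi> x * b (T (x /\<^sub>R \<epsilon> (r n)) \<omega>\<^sub>0) \<partial>lebesgue)
          \<longlonglongrightarrow> (\<integral>(x, \<omega>). u (x, \<omega>) * \<phi> x * b \<omega> \<partial>(lborel \<Otimes>\<^sub>M P))"
    if \<phi>: "\<phi> \<in> Cc_smooth" and b: "continuous_on UNIV b" for \<phi> b
  proof -
    define \<psi> where "\<psi> z = \<phi> (fst z) / weight (fst z) * b (snd z)" for z
    have "Ck 0 \<phi>" using \<phi> unfolding Cc_smooth_def by blast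
    then have "continuous_on UNIV \<phi>" by simp
    then have "continuous_on UNIV \<psi>" unfolding \<psi>_def using weight0
      by (auto intro!: continuous_intros continuous_on_compose2[OF _ continuous_on_fst]
          continuous_on_compose2[OF weight_continuous] continuous_on_compose2[OF b])
    moreover have "bounded {x. \<phi> x \<noteq> 0}"
      using \<phi> unfolding Cc_smooth_def by (auto intro: bounded_subset[OF compact_imp_bounded closure_subset])
    then obtain R where R: "\<And>x. \<phi> x \<noteq> 0 \<Longrightarrow> norm x \<le> R" by (auto simp: bounded_iff)
    obtain N :: nat where N: "R \<le> real N" using real_arch_simple by blast
    have "\<psi> (x, \<omega>) = 0" if "x \<notin> cball 0 (real N)" for x \<omega>
      using R[of x] N that by (auto simp: \<psi>_def)
    ultimately have "\<psi> \<in> test_functions" unfolding test_functions_def by blast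
    from bspec[OF lim this] show ?thesis
      using weight0 by (simp add: v_def \<psi>_def u_def split_beta' mult_ac)
  qed
  with u_loc u_exp r show ?thesis by blast
qed

end
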